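(* Let $\underline\lambda,\overline\lambda\in\mathbb{R}_{\ge 0}$ with $\underline\lambda\le\overline\lambda$. For all time points $s,t\in\mathbb{R}_{\ge 0}$ with $s\le t$ and all bounded functions $g\colon\mathbb{Z}_{\ge 0}\to\mathbb{R}$, $$\overline{\mathrm E}_{[\underline\lambda,\overline\lambda]}[g(N_t)\mid s]=[\overline{\mathrm S}_{t-s}\,g](N_s),$$ that is, $\overline{\mathrm E}_{[\underline\lambda,\overline\lambda]}[g(N_t)\mid s](\omega)=[\overline{\mathrm S}_{t-s}\,g](\omega(s))$ for all $\omega\in\Omega$.
   Context: Conventions: $\mathbb{N}=\{1,2,\dots\}$; $\mathbb{R}_{\ge 0}=[0,+\infty)$; $\overline{\mathbb{R}}=\mathbb{R}\cup\{-\infty,+\infty\}$ with $+\infty-\infty=+\infty$; $\inf\emptyset=+\infty$; "increasing" means nondecreasing. Sublinear Poisson semigroup. Let $\mathbb{G}$ be the set of bounded real functions on $\mathbb{Z}_{\ge 0}$, with the supremum norm. The sublinear Poisson generator $\overline{\mathrm G}\colon\mathbb{G}\to\mathbb{G}$ is $[\overline{\mathrm G}g](n)=\max\{\lambda(g(n+1)-g(n)):\lambda\in\{\underline\lambda,\overline\lambda\}\}$. For $\Delta\in\mathbb{R}_{\ge 0}$, $\overline{\mathrm S}_\Delta=e^{\Delta\overline{\mathrm G}}\colon\mathbb{G}\to\mathbb{G}$ is the operator exponential $\overline{\mathrm S}_\Delta g=\lim_{k\to+\infty}\big(\mathrm I+\tfrac{\Delta}{k}\overline{\mathrm G}\big)^k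 g$ (limit in supremum norm, which exists), with $\mathrm I$ the identity operator and powers denoting composition. Paths and variables. $\Omega$ is the set of counting paths: maps $\omega\colon\mathbb{R}_{\ge 0}\to\mathbb{Z}_{\ge 0}$ with $\omega(0)=0$ that are nondecreasing with unit jumps (every jump has size $1$) and right-continuous. A (partial) extended real variable is a map from (a subset of) $\Omega$ to $\overline{\mathbb{R}}$; "real" means it takes values in $\mathbb{R}$. For $t\in\mathbb{R}_{\ge 0}$, $N_t(\omega)=\omega(t)$. A stopping time is a map $\tau\colon\Omega\to[0,+\infty]$ such that for all $\omega_1,\omega_2\in\Omega$, if $\omega_1,\omega_2$ agree on $[0,\tau(\omega_1)]\cap\mathbb{R}_{\ge 0}$ then $\tau(\omega_1)=\tau(\omega_2)$; every $t\in\mathbb{R}_{\ge 0}$ is identified with the constant stopping time $t$. For a real-valued stopping time $\sigma$, $N_\sigma(\omega)=\omega(\sigma(\omega))$. For a stopping time $\tau$ and $\omega\in\Omega$, $\mathcal{I}_\tau(\omega)$ is the set of $\varpi\in\Omega$ that agree with $\omega$ on $[0,\tau(\omega)]\cap\mathbb{R}_{\ge 0}$. A partial variable $f$ is $\tau$-measurable if $f(\omega_1)=f(\omega_2)$ for all $\omega_1,\omega_2\in\operatorname{dom}f$ that agree on $[0,\tau(\omega_1)]\cap\mathbb{R}_{\ge 0}$. $\{\tau<+\infty\}=\{\omega\in\Omega:\tau(\omega)<+\infty\}$, and $\overline{\mathbb{V}}_\tau$ is the set of extended real partial variables whose domain includes $\{\tau<+\infty\}$. A process is a family $\mathcal{S}_\bullet=(\mathcal{S}_t)_{t\in\mathbb{R}_{\ge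 0}}$ of real variables on $\Omega$ with $\mathcal{S}_t$ $t$-measurable for all $t$; $\inf\mathcal{S}_\bullet=\inf_{t,\omega}\mathcal{S}_t(\omega)$; $\mathcal{S}_\tau(\omega)=\mathcal{S}_{\tau(\omega)}(\omega)$ for $\omega\in\{\tau<+\infty\}$; $\liminf\mathcal{S}_\bullet(\omega)=\liminf_{t\to+\infty}\mathcal{S}_t(\omega)$. Capital processes. A one-sided elementary trading strategy $G$ consists of finitely many stopping times $\tau_1\le\tau_2\le\cdots\le\tau_{n+1}$ ($n\in\mathbb{N}$) and stakes $\overline h_1,\underline h_1,\dots,\overline h_n,\underline h_n$, where $\overline h_k,\underline h_k$ are $\tau_k$-measurable bounded nonnegative real (possibly partial) variables whose domains include $\{\tau_k<+\infty\}$. With initial capital $c\in\mathbb{R}$ its capital process is $$\mathcal{K}^{G,c}_t=c+\sum_{k=1}^n\Big(\overline h_k\big(N_{\tau_{k+1}\wedge t}-N_{\tau_k\wedge t}-\overline\lambda(\tau_{k+1}\wedge t-\tau_k\wedge t)\big)+\underline h_k\big(\underline\lambda(\tau_{k+1}\wedge t-\tau_k\wedge t)-N_{\tau_{k+1}\wedge t}+N_{\tau_k\wedge t}\big)\Big),$$ where terms with $\tau_k(\omega)\wedge t=\tau_{k+1}(\omega)\wedge t$ count as zero. $\mathfrak{K}_{[\underline\lambda,\overline\lambda]}$ is the set of all such processes $\mathcal{K}^{G,c}_\bullet$. Upper expectation. For a stopping time $\tau$, $f\in\overline{\mathbb{V}}_\tau$ and $\omega\in\{\tau<+\infty\}$,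 $$\overline{\mathrm E}_{[\underline\lambda,\overline\lambda]}[f\mid\tau](\omega)=\inf\{\mathcal{K}_\tau(\omega):\mathcal{K}_\bullet\in\mathfrak{K}_{[\underline\lambda,\overline\lambda]},\ \inf\mathcal{K}_\bullet>-\infty,\ \liminf\mathcal{K}_\bullet(\varpi)\ge f(\varpi)\ \forall\varpi\in\mathcal{I}_\tau(\omega)\}.$$ *)

theory Defs
  imports "HOL-Analysis.Analysis"
begin

section \<open>The sublinear Poisson semigroup\<close>

text \<open>
  Bounded real functions on the nonnegative integers, with the supremum norm, are the type
  \<^typ>\<open>nat \<Rightarrow>\<^sub>C real\<close>: since \<^typ>\<open>nat\<close> carries the discrete topology, continuity is automatic.
\<close>

lemma bounded_imp_bcontfun_nat:
  fixes g :: "nat \<Rightarrow> real"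
  assumes "bounded (range g)"
  shows "g \<in> bcontfun"
  using assms by (simp add: bcontfun_def)

lemma apply_Bcontfun_nat:
  fixes g :: "nat \<Rightarrow> real"
  assumes "bounded (range g)"
  shows "apply_bcontfun (Bcontfun g) = g"
  by (rule Bcontfun_inverse[OF bounded_imp_bcontfun_nat[OF assms]])

definition poisson_generator :: "real \<Rightarrow> real \<Rightarrow> (nat \<Rightarrow>\<^sub>C real) \<Rightarrow> (nat \<Rightarrow>\<^sub>C real)" where
  "poisson_generator lo hi g =
     Bcontfun (\<lambda>n. MAX l\<in>{lo, hi}. l * (apply_bcontfun g (n + 1) - apply_bcontfun g n))"

lemma generator_bounded:
  fixes lo hi :: real and g :: "nat \<Rightarrow> real"
  assumes "bounded (range g)"
  shows "bounded (range (\<lambda>n. MAX l\<in>{lo, hi}. l * (g (n + 1) - g n)))"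
proof -
  from assms obtain B where B: "\<bar>g n\<bar> \<le> B" for n
    by (auto simp: bounded_iff)
  have "norm (MAX l\<in>{lo, hi}. l * (g (n + 1) - g n)) \<le> (\<bar>lo\<bar> + \<bar>hi\<bar>) * (2 * B)" for n
  proof -
    have d: "\<bar>g (n + 1) - g n\<bar> \<le> 2 * B"
      using B[of n] B[of "n + 1"] by linarith
    have "\<bar>l * (g (n + 1) - g n)\<bar> \<le> (\<bar>lo\<bar> + \<bar>hi\<bar>) * (2 * B)" if "l \<in> {lo, hi}" for l
      unfolding abs_mult using that d by (intro mult_mono) auto
    moreover have "(MAX l\<in>{lo, hi}. l * (g (n + 1) - g n)) \<in> (\<lambda>l. l * (g (n + 1) - g n)) ` {lo, hi}"
      by (intro Max_in) auto
    ultimately show ?thesis by auto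
  qed
  then show ?thesis
    by (intro boundedI) blast
qed

lemma apply_poisson_generator:
  "apply_bcontfun (poisson_generator lo hi g) n =
     (MAX l\<in>{lo, hi}. l * (apply_bcontfun g (n + 1) - apply_bcontfun g n))"
  unfolding poisson_generator_def
  by (simp only: apply_Bcontfun_nat[OF generator_bounded[OF bounded_apply_bcontfun]])

text \<open>The limit is taken in the supremum norm, as it is a limit in \<^typ>\<open>nat \<Rightarrow>\<^sub>C real\<close>.\<close>

definition poisson_semigroup :: "real \<Rightarrow> real \<Rightarrow> real \<Rightarrow> (nat \<Rightarrow>\<^sub>C real) \<Rightarrow> (nat \<Rightarrow>\<^sub>C real)" where
  "poisson_semigroup lo hi \<Delta> g =
     lim (\<lambda>k::nat. ((\<lambda>f. f + (\<Delta> / real k) *\<^sub>R poisson_generator lo hi f) ^^ k) g)"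


section \<open>Counting paths, stopping times and variables\<close>

text \<open>
  A path has domain \<open>{0..}\<close> and is therefore \<open>undefined\<close> at negative times. Stopping times and
  processes are HOL functions of an arbitrary \<^term>\<open>\<omega>\<close>, but only their values on counting paths
  (and, for processes, at nonnegative times) are ever used.
\<close>

type_synonym path = "real \<Rightarrow> nat"

definition counting_paths :: "path set" where
  "counting_paths = {\<omega> \<in> {0..} \<rightarrow>\<^sub>E UNIV.
     \<omega> 0 = 0 \<and> mono_on {0..} \<omega> \<and>
     (\<forall>t>0. \<exists>l. (\<omega> \<longlongrightarrow> l) (at_left t) \<and> (\<omega> t = l \<or> \<omega> t = l + 1)) \<and>
     (\<forall>t\<ge>0. continuous (at_right t) \<omega>)}"

definition agree_upto :: "ennreal \<Rightarrow> path \<Rightarrow> path \<Rightarrow> bool" where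
  "agree_upto T \<omega>1 \<omega>2 \<longleftrightarrow> (\<forall>r\<ge>0. ennreal r \<le> T \<longrightarrow> \<omega>1 r = \<omega>2 r)"

definition stopping_time :: "(path \<Rightarrow> ennreal) \<Rightarrow> bool" where
  "stopping_time \<tau> \<longleftrightarrow>
     (\<forall>\<omega>1\<in>counting_paths. \<forall>\<omega>2\<in>counting_paths. agree_upto (\<tau> \<omega>1) \<omega>1 \<omega>2 \<longrightarrow> \<tau> \<omega>1 = \<tau> \<omega>2)"

definition cylinder :: "(path \<Rightarrow> ennreal) \<Rightarrow> path \<Rightarrow> path set" where
  "cylinder \<tau> \<omega> = {\<omega>' \<in> counting_paths. agree_upto (\<tau> \<omega>) \<omega> \<omega>'}"

text \<open>Partial variables are maps \<open>path \<rightharpoonup> 'a\<close> with domain contained in \<^const>\<open>counting_paths\<close>.\<close>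

definition stopping_measurable :: "(path \<Rightarrow> ennreal) \<Rightarrow> (path \<rightharpoonup> 'a) \<Rightarrow> bool" where
  "stopping_measurable \<tau> f \<longleftrightarrow>
     (\<forall>\<omega>1\<in>dom f. \<forall>\<omega>2\<in>dom f. agree_upto (\<tau> \<omega>1) \<omega>1 \<omega>2 \<longrightarrow> f \<omega>1 = f \<omega>2)"


section \<open>Capital processes\<close>

definition stake :: "(path \<Rightarrow> ennreal) \<Rightarrow> (path \<rightharpoonup> real) \<Rightarrow> bool" where
  "stake \<tau> h \<longleftrightarrow>
     dom h \<subseteq> counting_paths \<and> {\<omega> \<in> counting_paths. \<tau> \<omega> < \<infinity>} \<subseteq> dom h \<and>
     stopping_measurable \<tau> h \<and> bounded (ran h) \<and> (\<forall>x\<in>ran h. 0 \<le> x)"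

text \<open>
  The stopping times are \<open>\<tau> 1, \<dots>, \<tau> (n + 1)\<close>; the stakes are \<open>hu k\<close> (rate \<open>hi\<close>) and
  \<open>hl k\<close> (rate \<open>lo\<close>) for \<open>k = 1, \<dots>, n\<close>.
\<close>

definition trading_strategy ::
  "nat \<Rightarrow> (nat \<Rightarrow> path \<Rightarrow> ennreal) \<Rightarrow> (nat \<Rightarrow> path \<rightharpoonup> real) \<Rightarrow> (nat \<Rightarrow> path \<rightharpoonup> real) \<Rightarrow> bool" where
  "trading_strategy n \<tau> hu hl \<longleftrightarrow>
     1 \<le> n \<and>
     (\<forall>k\<in>{1..n + 1}. stopping_time (\<tau> k)) \<and>
     (\<forall>k\<in>{1..n}. \<forall>\<omega>\<in>counting_paths. \<tau> k \<omega> \<le> \<tau> (k + 1) \<omega>) \<and>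
     (\<forall>k\<in>{1..n}. stake (\<tau> k) (hu k) \<and> stake (\<tau> k) (hl k))"

definition stop_at :: "(path \<Rightarrow> ennreal) \<Rightarrow> real \<Rightarrow> path \<Rightarrow> real" where
  "stop_at \<tau> t \<omega> = enn2real (min (\<tau> \<omega>) (ennreal t))"

definition capital ::
  "real \<Rightarrow> real \<Rightarrow> nat \<Rightarrow> (nat \<Rightarrow> path \<Rightarrow> ennreal) \<Rightarrow> (nat \<Rightarrow> path \<rightharpoonup> real) \<Rightarrow> (nat \<Rightarrow> path \<rightharpoonup> real)
    \<Rightarrow> real \<Rightarrow> real \<Rightarrow> path \<Rightarrow> real" where
  "capital lo hi n \<tau> hu hl c t \<omega> = c + (\<Sum>k=1..n.
     let a = stop_at (\<tau> k) t \<omega>; b = stop_at (\<tau> (k + 1)) t \<omega> in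
     if a = b then 0
     else the (hu k \<omega>) * (real (\<omega> b) - real (\<omega> a) - hi * (b - a))
        + the (hl k \<omega>) * (lo * (b - a) - real (\<omega> b) + real (\<omega> a)))"

definition capital_processes :: "real \<Rightarrow> real \<Rightarrow> (real \<Rightarrow> path \<Rightarrow> real) set" where
  "capital_processes lo hi =
     {capital lo hi n \<tau> hu hl c | n \<tau> hu hl c. trading_strategy n \<tau> hu hl}"


section \<open>Upper expectation\<close>

text \<open>
  Meant for a stopping time \<open>\<tau>\<close>, a path \<open>\<omega>\<close> with \<open>\<tau> \<omega> < \<infinity>\<close> and \<open>f\<close> with
  \<open>{\<omega> \<in> counting_paths. \<tau> \<omega> < \<infinity>} \<subseteq> dom f\<close>; then \<open>f\<close> is defined on the whole cylinder.
\<close>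

definition upper_expectation ::
  "real \<Rightarrow> real \<Rightarrow> (path \<rightharpoonup> ereal) \<Rightarrow> (path \<Rightarrow> ennreal) \<Rightarrow> path \<Rightarrow> ereal" where
  "upper_expectation lo hi f \<tau> \<omega> =
     Inf {ereal (K (enn2real (\<tau> \<omega>)) \<omega>) | K. K \<in> capital_processes lo hi \<and>
        (INF (t, \<omega>') \<in> {0..} \<times> counting_paths. ereal (K t \<omega>')) > -\<infinity> \<and>
        (\<forall>\<omega>'\<in>cylinder \<tau> \<omega>. Liminf at_top (\<lambda>t. ereal (K t \<omega>')) \<ge> the (f \<omega>'))}"

end

theory Submission
  imports Defs
begin

text \<open>
  The upper expectation is the least capital at time \<open>s\<close> that superhedges \<open>g (N\<^sub>t)\<close>, so the theorem
  consists of a lower and an upper bound for such capitals. Both are proved path by path and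
  compare the semigroup with its Euler scheme \<open>(I + \<delta> G)\<^sup>k\<close> of mesh \<open>\<delta> = (t - s) / k\<close>. An Euler
  step with \<open>\<delta> hi \<le> 1\<close> is a maximum of averages of \<open>f n\<close> and \<open>f (n + 1)\<close>, hence nonexpansive, and
  so the local errors, of order \<open>\<delta>\<^sup>2\<close>, only add up
  (\<open>euler_power_refine\<close>, \<open>euler_power_approximates_semigroup\<close>).

  Lower bound. Stakes and stopping times are arbitrary functions of the past of the path, so a
  capital process cannot be integrated against a law of the path. Instead, an adversary picks one
  path that beats a given strategy up to an arbitrarily small error. Against constant stakes it
  decides at each grid point whether to jump. If it jumped with probability \<open>l \<delta>\<close>, where \<open>l\<close> is
  the rate that attains the maximum in the generator, then the value function would be preserved
  in the mean, and the gain of the trader would not be positive in the mean, as \<open>l\<close> lies between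
  \<open>lo\<close> and \<open>hi\<close>. Hence one of the two choices is at least as good as the mean
  (\<open>adversary_step\<close>). Since the stakes on \<open>]\<tau>\<^sub>k, \<tau>\<^sub>k\<^sub>+\<^sub>1]\<close> are known at \<open>\<tau>\<^sub>k\<close>, the adversary can commit
  at \<open>\<tau>\<^sub>k\<close> to a path for all later times and revise it only at \<open>\<tau>\<^sub>k\<^sub>+\<^sub>1\<close>. There are finitely many
  stopping times, so finitely many revisions are made (\<open>adversary_path\<close>, \<open>semigroup_le_capital\<close>).

  Upper bound. On each grid cell the trader starts with the discrete derivative of the value
  function as stake. Held over the whole cell, it would replicate the Euler step exactly on paths
  with at most one jump there. At the first jump in the cell the trader changes to a stake that
  covers any number of further jumps. Giving up the former stake early and holding the latter one
  costs an amount of order \<open>\<delta>\<close>, but only in cells with a jump; an additional stake \<open>\<epsilon>\<close>, which wins \<open>\<epsilon>\<close>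
  at that jump, pays for it when \<open>\<delta>\<close> is small compared with \<open>\<epsilon>\<close>. Holding the stake \<open>\<epsilon>\<close>
  costs at most \<open>\<epsilon> hi (t - s)\<close> in total (\<open>hedge_one_interval\<close>, \<open>superhedging_capital\<close>).
\<close>


section \<open>The Euler scheme of the Poisson semigroup\<close>

lemma poisson_generator_diff_le:
  assumes "0 \<le> lo" "lo \<le> hi"
  shows "norm (poisson_generator lo hi f - poisson_generator lo hi h) \<le> 2 * hi * norm (f - h)"
proof (rule norm_bound)
  fix n
  let ?a = "apply_bcontfun f (n + 1) - apply_bcontfun f n"
  let ?b = "apply_bcontfun h (n + 1) - apply_bcontfun h n"
  have ab: "\<bar>?a - ?b\<bar> \<le> 2 * norm (f - h)"
    using norm_bounded[of "f - h" n] norm_bounded[of "f - h" "n + 1"] by simp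
  have *: "\<bar>l * ?a - l * ?b\<bar> \<le> 2 * hi * norm (f - h)" if "0 \<le> l" "l \<le> hi" for l
  proof -
    have "\<bar>l * ?a - l * ?b\<bar> = l * \<bar>?a - ?b\<bar>"
      using that by (simp add: abs_mult flip: right_diff_distrib)
    also have "\<dots> \<le> hi * (2 * norm (f - h))"
      using that ab assms by (intro mult_mono) auto
    finally show ?thesis by simp
  qed
  show "norm (apply_bcontfun (poisson_generator lo hi f - poisson_generator lo hi h) n)
      \<le> 2 * hi * norm (f - h)"
    using *[of lo] *[of hi] assms
    by (auto simp add: apply_poisson_generator max_def abs_le_iff split: if_splits)
qed

definition euler_step :: "real \<Rightarrow> real \<Rightarrow> real \<Rightarrow> (nat \<Rightarrow>\<^sub>C real) \<Rightarrow> (nat \<Rightarrow>\<^sub>C real)" where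
  "euler_step lo hi \<delta> f = f + \<delta> *\<^sub>R poisson_generator lo hi f"

lemma poisson_semigroup_euler:
  "poisson_semigroup lo hi \<Delta> g = lim (\<lambda>k. (euler_step lo hi (\<Delta> / real k) ^^ k) g)"
  by (simp add: poisson_semigroup_def euler_step_def[abs_def])

text \<open>
  The step is a maximum over the rates \<open>l\<close> of the mean of \<open>f\<close> after a jump of probability \<open>\<delta> l\<close>,
  provided that \<open>\<delta> l \<le> 1\<close>. Both the nonexpansiveness and the adversary rest on this form.
\<close>

lemma apply_euler_step:
  "0 \<le> \<delta> \<Longrightarrow> apply_bcontfun (euler_step lo hi \<delta> f) n =
     (MAX l\<in>{lo, hi}. (1 - \<delta> * l) * apply_bcontfun f n + \<delta> * l * apply_bcontfun f (n + 1))"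
  by (simp add: euler_step_def apply_poisson_generator max_mult_distrib_left max_add_distrib_right algebra_simps)

lemma tendsto_apply_bcontfun:
  assumes "(f \<longlongrightarrow> l) F"
  shows "((\<lambda>k. apply_bcontfun (f k) x) \<longlongrightarrow> apply_bcontfun l x) F"
proof (rule tendstoI)
  fix e :: real assume "0 < e"
  with assms have "\<forall>\<^sub>F k in F. dist (f k) l < e" by (rule tendstoD)
  then show "\<forall>\<^sub>F k in F. dist (apply_bcontfun (f k) x) (apply_bcontfun l x) < e"
    by (rule eventually_mono) (rule dist_fun_lt_imp_dist_val_lt)
qed

text \<open>
  Completeness comes from the target space alone, so the domain needs only a topology.
\<close>

lemma Cauchy_bcontfun_convergent:
  fixes a :: "nat \<Rightarrow> ('a::topological_space \<Rightarrow>\<^sub>C 'b::banach)"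
  assumes "Cauchy a"
  shows "convergent a"
proof -
  have "uniformly_Cauchy_on UNIV (\<lambda>k. apply_bcontfun (a k))"
    unfolding uniformly_Cauchy_on_def
    by (metis CauchyD assms dist_norm dist_fun_lt_imp_dist_val_lt)
  then obtain l where "uniform_limit UNIV (\<lambda>k. apply_bcontfun (a k)) l sequentially"
    using Cauchy_uniformly_convergent uniformly_convergent_on_def by blast
  then show ?thesis
    by (metis uniform_limit_bcontfunE sequentially_bot convergentI)
qed

context
  fixes lo hi :: real
  assumes lo_nonneg: "0 \<le> lo" and lo_le_hi: "lo \<le> hi"
begin

lemma poisson_generator_zero: "poisson_generator lo hi 0 = 0"
  by (rule bcontfun_eqI) (simp add: apply_poisson_generator)

lemma norm_poisson_generator_le: "norm (poisson_generator lo hi f) \<le> 2 * hi * norm f"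
  using poisson_generator_diff_le[OF lo_nonneg lo_le_hi, of f 0] by (simp add: poisson_generator_zero)

lemma euler_step_zero_time [simp]: "euler_step lo hi 0 f = f"
  by (simp add: euler_step_def)

text \<open>
  Averages and maxima are nonexpansive; the bound on \<open>\<delta>\<close> makes the weights in
  \<open>apply_euler_step\<close> nonnegative.
\<close>

lemma euler_step_nonexpansive:
  assumes "0 \<le> \<delta>" "\<delta> * hi \<le> 1"
  shows "norm (euler_step lo hi \<delta> f - euler_step lo hi \<delta> h) \<le> norm (f - h)"
proof (rule norm_bound)
  fix n
  have *: "\<bar>((1 - \<delta> * l) * apply_bcontfun f n + \<delta> * l * apply_bcontfun f (n + 1))
           - ((1 - \<delta> * l) * apply_bcontfun h n + \<delta> * l * apply_bcontfun h (n + 1))\<bar> \<le> norm (f - h)"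
    if l: "0 \<le> l" "l \<le> hi" for l
  proof -
    have p: "0 \<le> \<delta> * l" "\<delta> * l \<le> 1"
      using assms l mult_left_mono[of l hi \<delta>] by auto
    have "\<bar>(1 - \<delta> * l) * (apply_bcontfun f n - apply_bcontfun h n)
        + \<delta> * l * (apply_bcontfun f (n + 1) - apply_bcontfun h (n + 1))\<bar>
      \<le> (1 - \<delta> * l) * \<bar>apply_bcontfun f n - apply_bcontfun h n\<bar>
        + \<delta> * l * \<bar>apply_bcontfun f (n + 1) - apply_bcontfun h (n + 1)\<bar>"
      using p assms(1) l by (intro order.trans[OF abs_triangle_ineq]) (simp add: abs_mult)
    also have "\<dots> \<le> (1 - \<delta> * l) * norm (f - h) + \<delta> * l * norm (f - h)"
      using p norm_bounded[of "f - h" n] norm_bounded[of "f - h" "n + 1"]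
      by (intro add_mono mult_left_mono) auto
    finally show ?thesis by (simp add: algebra_simps)
  qed
  show "norm (apply_bcontfun (euler_step lo hi \<delta> f - euler_step lo hi \<delta> h) n) \<le> norm (f - h)"
    unfolding minus_bcontfun.rep_eq apply_euler_step[OF assms(1)]
    using *[of lo] *[of hi] lo_nonneg lo_le_hi
    by (auto simp: max_def abs_le_iff split: if_splits)
qed

lemma euler_power_nonexpansive:
  assumes "0 \<le> \<delta>" "\<delta> * hi \<le> 1"
  shows "norm ((euler_step lo hi \<delta> ^^ k) f - (euler_step lo hi \<delta> ^^ k) h) \<le> norm (f - h)"
  by (induction k) (auto intro: order.trans[OF euler_step_nonexpansive[OF assms]])

lemma norm_euler_power_le:
  assumes "0 \<le> \<delta>" "\<delta> * hi \<le> 1"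
  shows "norm ((euler_step lo hi \<delta> ^^ k) f) \<le> norm f"
proof -
  have "(euler_step lo hi \<delta> ^^ k) 0 = 0"
    by (induction k) (auto simp: euler_step_def poisson_generator_zero)
  then show ?thesis
    using euler_power_nonexpansive[OF assms, of k f 0] by simp
qed

lemma euler_power_drift:
  assumes "0 \<le> \<delta>" "\<delta> * hi \<le> 1"
  shows "norm ((euler_step lo hi \<delta> ^^ k) f - f) \<le> real k * \<delta> * (2 * hi * norm f)"
proof (induction k)
  case (Suc k)
  let ?f = "(euler_step lo hi \<delta> ^^ k) f"
  have "norm (poisson_generator lo hi ?f) \<le> 2 * hi * norm f"
    using norm_poisson_generator_le[of ?f] norm_euler_power_le[OF assms, of k f] lo_nonneg lo_le_hi
    by (meson mult_left_mono order.trans mult_nonneg_nonneg zero_le_numeral)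
  then have "norm (\<delta> *\<^sub>R poisson_generator lo hi ?f) \<le> \<delta> * (2 * hi * norm f)"
    using assms(1) by (simp add: mult_left_mono)
  moreover have "(euler_step lo hi \<delta> ^^ Suc k) f - f = (?f - f) + \<delta> *\<^sub>R poisson_generator lo hi ?f"
    by (simp add: euler_step_def)
  ultimately have "norm ((euler_step lo hi \<delta> ^^ Suc k) f - f)
      \<le> real k * \<delta> * (2 * hi * norm f) + \<delta> * (2 * hi * norm f)"
    using Suc norm_triangle_mono by metis
  then show ?case by (simp add: algebra_simps)
qed simp

text \<open>
  The local error: all of the \<open>j\<close> small steps start within order \<open>\<delta>\<close> of \<open>f\<close>, where the Lipschitz
  generator differs by order \<open>\<delta>\<close> from its value at \<open>f\<close>.
\<close>

lemma euler_step_refine: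
  assumes "0 \<le> \<delta>" "\<delta> * hi \<le> 1" "0 < j"
  shows "norm ((euler_step lo hi (\<delta> / real j) ^^ j) f - euler_step lo hi \<delta> f)
    \<le> (2 * hi * \<delta>)\<^sup>2 * norm f"
proof -
  let ?\<eta> = "\<delta> / real j"
  have "?\<eta> \<le> \<delta>"
    using assms by (simp add: divide_le_eq mult_le_cancel_left1)
  then have \<eta>: "0 \<le> ?\<eta>" "?\<eta> * hi \<le> 1"
    using assms mult_right_mono[of ?\<eta> \<delta> hi] lo_nonneg lo_le_hi by auto
  have "norm ((euler_step lo hi ?\<eta> ^^ i) f - (f + (real i * ?\<eta>) *\<^sub>R poisson_generator lo hi f))
      \<le> real i * (?\<eta> * (2 * hi * (\<delta> * (2 * hi * norm f))))" if "i \<le> j" for i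
    using that
  proof (induction i)
    case (Suc i)
    let ?f = "(euler_step lo hi ?\<eta> ^^ i) f"
    let ?d = "poisson_generator lo hi ?f - poisson_generator lo hi f"
    have "real i * ?\<eta> \<le> \<delta>"
      using Suc assms by (simp add: field_simps mult_left_mono)
    then have "real i * ?\<eta> * (2 * hi * norm f) \<le> \<delta> * (2 * hi * norm f)"
      using lo_nonneg lo_le_hi by (intro mult_right_mono) auto
    then have "norm (?f - f) \<le> \<delta> * (2 * hi * norm f)"
      using euler_power_drift[OF \<eta>, of i f] by linarith
    then have "norm ?d \<le> 2 * hi * (\<delta> * (2 * hi * norm f))"
      using poisson_generator_diff_le[OF lo_nonneg lo_le_hi, of ?f f] lo_nonneg lo_le_hi
      by (meson mult_left_mono order.trans mult_nonneg_nonneg zero_le_numeral)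
    then have "norm (?\<eta> *\<^sub>R ?d) \<le> ?\<eta> * (2 * hi * (\<delta> * (2 * hi * norm f)))"
      unfolding norm_scaleR using \<eta>(1) by (metis abs_of_nonneg mult_left_mono)
    moreover have "(euler_step lo hi ?\<eta> ^^ Suc i) f
          - (f + (real (Suc i) * ?\<eta>) *\<^sub>R poisson_generator lo hi f)
        = (?f - (f + (real i * ?\<eta>) *\<^sub>R poisson_generator lo hi f)) + ?\<eta> *\<^sub>R ?d"
    proof -
      have "(u + \<eta> *\<^sub>R v) - (f + (real (Suc i) * \<eta>) *\<^sub>R w) = (u - (f + (real i * \<eta>) *\<^sub>R w)) + \<eta> *\<^sub>R (v - w)"
        for u v w :: "nat \<Rightarrow>\<^sub>C real" and \<eta> :: real
        by (simp add: algebra_simps)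
      then show ?thesis by (simp only: euler_step_def funpow.simps o_apply)
    qed
    ultimately have "norm ((euler_step lo hi ?\<eta> ^^ Suc i) f
          - (f + (real (Suc i) * ?\<eta>) *\<^sub>R poisson_generator lo hi f))
        \<le> real i * (?\<eta> * (2 * hi * (\<delta> * (2 * hi * norm f)))) + ?\<eta> * (2 * hi * (\<delta> * (2 * hi * norm f)))"
      using norm_triangle_mono[OF Suc.IH[OF Suc_leD[OF Suc.prems]]] by metis
    moreover have "real (Suc i) * c = real i * c + c" for c :: real
      by (simp add: algebra_simps)
    ultimately show ?case by metis
  qed simp
  from this[of j] show ?thesis
    using assms by (simp add: euler_step_def power2_eq_square mult_ac)
qed

text \<open>
  The local errors add up without being amplified, because the small steps are nonexpansive.
\<close>

lemma euler_power_refine: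
  assumes "0 \<le> \<delta>" "\<delta> * hi \<le> 1" "0 < j"
  shows "norm ((euler_step lo hi (\<delta> / real j) ^^ (j * k)) f - (euler_step lo hi \<delta> ^^ k) f)
    \<le> real k * ((2 * hi * \<delta>)\<^sup>2 * norm f)"
proof (induction k)
  case (Suc k)
  let ?\<eta> = "\<delta> / real j"
  let ?E = "euler_step lo hi ?\<eta>" and ?F = "euler_step lo hi \<delta>"
  have "?\<eta> \<le> \<delta>"
    using assms by (simp add: divide_le_eq mult_le_cancel_left1)
  then have \<eta>: "0 \<le> ?\<eta>" "?\<eta> * hi \<le> 1"
    using assms mult_right_mono[of ?\<eta> \<delta> hi] lo_nonneg lo_le_hi by auto
  have "norm ((?E ^^ j) ((?E ^^ (j * k)) f) - (?E ^^ j) ((?F ^^ k) f))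
      \<le> real k * ((2 * hi * \<delta>)\<^sup>2 * norm f)"
    using euler_power_nonexpansive[OF \<eta>] Suc by (rule order.trans)
  moreover have "norm ((?E ^^ j) ((?F ^^ k) f) - ?F ((?F ^^ k) f)) \<le> (2 * hi * \<delta>)\<^sup>2 * norm f"
    using euler_step_refine[OF assms, of "(?F ^^ k) f"] norm_euler_power_le[OF assms(1,2), of k f]
    by (meson mult_left_mono order.trans zero_le_power2)
  moreover have "(?E ^^ (j * Suc k)) f - (?F ^^ Suc k) f
     = ((?E ^^ j) ((?E ^^ (j * k)) f) - (?E ^^ j) ((?F ^^ k) f))
       + ((?E ^^ j) ((?F ^^ k) f) - ?F ((?F ^^ k) f))"
    by (simp add: funpow_add)
  ultimately have "norm ((?E ^^ (j * Suc k)) f - (?F ^^ Suc k) f)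
     \<le> real k * ((2 * hi * \<delta>)\<^sup>2 * norm f) + (2 * hi * \<delta>)\<^sup>2 * norm f"
    using norm_triangle_mono by metis
  then show ?case by (simp add: algebra_simps)
qed simp

text \<open>
  Both schemes are close to their common refinement with \<open>j * k\<close> steps.
\<close>

lemma euler_scheme_cauchy_bound:
  assumes "0 \<le> \<Delta>" "0 < k" "0 < j" "\<Delta> * hi \<le> real k" "\<Delta> * hi \<le> real j"
  shows "norm ((euler_step lo hi (\<Delta> / real k) ^^ k) g - (euler_step lo hi (\<Delta> / real j) ^^ j) g)
    \<le> (2 * hi * \<Delta>)\<^sup>2 * norm g * (1 / real k + 1 / real j)"
proof -
  let ?a = "\<lambda>k. (euler_step lo hi (\<Delta> / real k) ^^ k) g"
  have *: "norm (?a (j * k) - ?a k) \<le> (2 * hi * \<Delta>)\<^sup>2 * norm g * (1 / real k)"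
    if "0 < k" "0 < j" "\<Delta> * hi \<le> real k" for k j :: nat
  proof -
    have "\<Delta> / real k / real j = \<Delta> / real (j * k)" "\<Delta> / real k * hi \<le> 1"
      using that by (simp_all add: mult.commute[of "real j"])
    moreover have "real k * ((2 * hi * (\<Delta> / real k))\<^sup>2 * norm g) = (2 * hi * \<Delta>)\<^sup>2 * norm g * (1 / real k)"
      using that by (simp add: power2_eq_square)
    ultimately show ?thesis
      using euler_power_refine[of "\<Delta> / real k" j k g] that assms(1) by (simp only: divide_nonneg_nonneg of_nat_0_le_iff simp_thms)
  qed
  have "norm (?a (j * k) - ?a k) \<le> (2 * hi * \<Delta>)\<^sup>2 * norm g * (1 / real k)"
       "norm (?a (k * j) - ?a j) \<le> (2 * hi * \<Delta>)\<^sup>2 * norm g * (1 / real j)"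
    using * assms by blast+
  moreover have "norm (?a k - ?a j) \<le> norm (?a (j * k) - ?a k) + norm (?a (k * j) - ?a j)"
    using norm_triangle_ineq4[of "?a (j * k) - ?a j" "?a (j * k) - ?a k"] by (simp add: mult.commute)
  ultimately show ?thesis by (simp add: distrib_left)
qed

lemma euler_scheme_tendsto:
  assumes "0 \<le> \<Delta>"
  shows "(\<lambda>k. (euler_step lo hi (\<Delta> / real k) ^^ k) g) \<longlonglongrightarrow> poisson_semigroup lo hi \<Delta> g"
proof -
  let ?a = "\<lambda>k. (euler_step lo hi (\<Delta> / real k) ^^ k) g"
  let ?M = "(2 * hi * \<Delta>)\<^sup>2 * norm g"
  have "Cauchy ?a"
  proof (rule CauchyI)
    fix e :: real assume e: "0 < e"
    obtain K1 :: nat where K1: "\<Delta> * hi \<le> real K1" using real_arch_simple by blast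
    obtain K2 :: nat where K2: "2 * ?M / e \<le> real K2" using real_arch_simple by blast
    have "norm (?a m - ?a n) < e" if mn: "m \<ge> Suc (K1 + K2)" "n \<ge> Suc (K1 + K2)" for m n
    proof -
      have "norm (?a m - ?a n) \<le> ?M * (1 / real m + 1 / real n)"
        using mn K1 assms by (intro euler_scheme_cauchy_bound) auto
      also have "\<dots> \<le> ?M * (1 / real (Suc K2) + 1 / real (Suc K2))"
        using mn by (intro mult_left_mono add_mono divide_left_mono) auto
      also have "\<dots> < e"
      proof -
        have "2 * ?M \<le> e * real K2" using K2 e by (simp add: field_simps)
        also have "\<dots> < e * real (Suc K2)" using e by simp
        finally show ?thesis by (simp add: field_simps)
      qed
      finally show ?thesis .
    qed
    then show "\<exists>N. \<forall>m\<ge>N. \<forall>n\<ge>N. norm (?a m - ?a n) < e" by blast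
  qed
  then have "convergent ?a" by (rule Cauchy_bcontfun_convergent)
  then show ?thesis
    by (simp add: poisson_semigroup_euler convergent_LIMSEQ_iff)
qed

text \<open>
  The error is at most a multiple of \<open>\<delta>\<close> for all \<open>k\<close> with \<open>k \<delta>\<close> bounded, hence uniformly over all
  grid points of a bounded time interval.
\<close>

lemma euler_power_approximates_semigroup:
  assumes "0 \<le> \<delta>" "\<delta> * hi \<le> 1"
  shows "norm ((euler_step lo hi \<delta> ^^ k) g - poisson_semigroup lo hi (real k * \<delta>) g)
    \<le> real k * \<delta> * \<delta> * ((2 * hi)\<^sup>2 * norm g)"
proof (cases "k = 0")
  case True
  have "euler_step lo hi 0 = id" by (auto simp: fun_eq_iff)
  then have "(\<lambda>k. (euler_step lo hi (0 / real k) ^^ k) g) = (\<lambda>k. g)" by simp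
  then have "poisson_semigroup lo hi 0 g = g"
    using euler_scheme_tendsto[of 0 g] by (simp add: LIMSEQ_const_iff)
  then show ?thesis using True by simp
next
  case False
  let ?\<Delta> = "real k * \<delta>"
  let ?a = "\<lambda>k. (euler_step lo hi (?\<Delta> / real k) ^^ k) g"
  have \<Delta>: "0 \<le> ?\<Delta>" using assms by simp
  have "(\<lambda>j. norm (?a k - ?a j)) \<longlonglongrightarrow> norm (?a k - poisson_semigroup lo hi ?\<Delta> g)"
    by (intro tendsto_intros euler_scheme_tendsto \<Delta>)
  moreover have "(\<lambda>j. (2 * hi * ?\<Delta>)\<^sup>2 * norm g * (1 / real k + 1 / real j))
      \<longlonglongrightarrow> (2 * hi * ?\<Delta>)\<^sup>2 * norm g * (1 / real k + 0)"
    by (intro tendsto_intros lim_1_over_n)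
  moreover have "\<exists>N. \<forall>j\<ge>N. norm (?a k - ?a j) \<le> (2 * hi * ?\<Delta>)\<^sup>2 * norm g * (1 / real k + 1 / real j)"
  proof -
    obtain N :: nat where N: "?\<Delta> * hi \<le> real N" using real_arch_simple by blast
    have "?\<Delta> * hi \<le> real k" using assms(2) False by (simp add: mult.assoc mult_le_cancel_left2)
    then show ?thesis
      using N False \<Delta> by (intro exI[of _ "Suc N"] allI impI euler_scheme_cauchy_bound) auto
  qed
  ultimately have "norm (?a k - poisson_semigroup lo hi ?\<Delta> g) \<le> (2 * hi * ?\<Delta>)\<^sup>2 * norm g * (1 / real k + 0)"
    by (rule LIMSEQ_le)
  then show ?thesis using False by (simp add: power2_eq_square mult_ac)
qed

lemma semigroup_zero_time: "poisson_semigroup lo hi 0 g = g"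
  using euler_power_approximates_semigroup[of 0 0 g] by simp

text \<open>
  The two Euler schemes with the same number \<open>k\<close> of steps drift apart by at most
  \<open>\<bar>\<Delta> - \<Delta>'\<bar> / k\<close> times a bound for the generator in each step.
\<close>

lemma semigroup_time_lipschitz:
  assumes "0 \<le> \<Delta>" "0 \<le> \<Delta>'"
  shows "norm (poisson_semigroup lo hi \<Delta> g - poisson_semigroup lo hi \<Delta>' g)
    \<le> \<bar>\<Delta> - \<Delta>'\<bar> * (2 * hi * norm g)"
proof -
  have step: "norm ((euler_step lo hi \<delta> ^^ k) g - (euler_step lo hi \<delta>' ^^ k) g)
      \<le> real k * \<bar>\<delta> - \<delta>'\<bar> * (2 * hi * norm g)"
    if "0 \<le> \<delta>" "\<delta> * hi \<le> 1" "0 \<le> \<delta>'" "\<delta>' * hi \<le> 1" for \<delta> \<delta>' k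
  proof (induction k)
    case (Suc k)
    let ?f = "(euler_step lo hi \<delta> ^^ k) g" and ?f' = "(euler_step lo hi \<delta>' ^^ k) g"
    have "norm (euler_step lo hi \<delta> ?f - euler_step lo hi \<delta> ?f') \<le> real k * \<bar>\<delta> - \<delta>'\<bar> * (2 * hi * norm g)"
      using euler_step_nonexpansive[OF that(1,2)] Suc by (rule order.trans)
    moreover have "norm ((\<delta> - \<delta>') *\<^sub>R poisson_generator lo hi ?f') \<le> \<bar>\<delta> - \<delta>'\<bar> * (2 * hi * norm g)"
    proof -
      have "norm (poisson_generator lo hi ?f') \<le> 2 * hi * norm g"
        using norm_poisson_generator_le[of ?f'] norm_euler_power_le[OF that(3,4), of k g] lo_nonneg lo_le_hi
        by (meson mult_left_mono order.trans mult_nonneg_nonneg zero_le_numeral)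
      then show ?thesis by (simp add: mult_left_mono)
    qed
    moreover have "(euler_step lo hi \<delta> ^^ Suc k) g - (euler_step lo hi \<delta>' ^^ Suc k) g
      = (euler_step lo hi \<delta> ?f - euler_step lo hi \<delta> ?f') + (\<delta> - \<delta>') *\<^sub>R poisson_generator lo hi ?f'"
      by (simp add: euler_step_def algebra_simps)
    ultimately have "norm ((euler_step lo hi \<delta> ^^ Suc k) g - (euler_step lo hi \<delta>' ^^ Suc k) g)
      \<le> real k * \<bar>\<delta> - \<delta>'\<bar> * (2 * hi * norm g) + \<bar>\<delta> - \<delta>'\<bar> * (2 * hi * norm g)"
      using norm_triangle_mono by metis
    then show ?case by (simp add: algebra_simps)
  qed simp
  have "(\<lambda>k. norm ((euler_step lo hi (\<Delta> / real k) ^^ k) g - (euler_step lo hi (\<Delta>' / real k) ^^ k) g))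
      \<longlonglongrightarrow> norm (poisson_semigroup lo hi \<Delta> g - poisson_semigroup lo hi \<Delta>' g)"
    by (intro tendsto_intros euler_scheme_tendsto assms)
  moreover have "\<exists>N. \<forall>k\<ge>N. norm ((euler_step lo hi (\<Delta> / real k) ^^ k) g
      - (euler_step lo hi (\<Delta>' / real k) ^^ k) g) \<le> \<bar>\<Delta> - \<Delta>'\<bar> * (2 * hi * norm g)"
  proof -
    obtain N :: nat where N: "\<Delta> * hi + \<Delta>' * hi \<le> real N" using real_arch_simple by blast
    have nn: "0 \<le> \<Delta> * hi" "0 \<le> \<Delta>' * hi" using assms lo_nonneg lo_le_hi by auto
    have "norm ((euler_step lo hi (\<Delta> / real k) ^^ k) g - (euler_step lo hi (\<Delta>' / real k) ^^ k) g)
      \<le> \<bar>\<Delta> - \<Delta>'\<bar> * (2 * hi * norm g)" if k: "Suc N \<le> k" for k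
    proof -
      have "\<Delta> * hi \<le> real k" "\<Delta>' * hi \<le> real k" using N nn k by linarith+
      then have "norm ((euler_step lo hi (\<Delta> / real k) ^^ k) g - (euler_step lo hi (\<Delta>' / real k) ^^ k) g)
         \<le> real k * \<bar>\<Delta> / real k - \<Delta>' / real k\<bar> * (2 * hi * norm g)"
        using k assms by (intro step) (auto simp: field_simps)
      also have "real k * \<bar>\<Delta> / real k - \<Delta>' / real k\<bar> = \<bar>\<Delta> - \<Delta>'\<bar>"
        using k by (simp add: abs_divide flip: diff_divide_distrib)
      finally show ?thesis .
    qed
    then show ?thesis by blast
  qed
  ultimately show ?thesis by (rule LIMSEQ_le_const2)
qed

end


section \<open>Counting paths\<close>

lemma counting_path_start: "\<omega> \<in> counting_paths \<Longrightarrow> \<omega> 0 = 0"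
  by (simp add: counting_paths_def)

lemma counting_path_mono: "\<omega> \<in> counting_paths \<Longrightarrow> 0 \<le> u \<Longrightarrow> u \<le> v \<Longrightarrow> \<omega> u \<le> \<omega> v"
  by (auto simp: counting_paths_def mono_on_def)

lemma counting_path_right_locally_constant:
  assumes "\<omega> \<in> counting_paths" "0 \<le> u"
  obtains v where "u < v" "\<And>r. u \<le> r \<Longrightarrow> r < v \<Longrightarrow> \<omega> r = \<omega> u"
proof -
  have "(\<omega> \<longlongrightarrow> \<omega> u) (at_right u)"
    using assms by (simp add: counting_paths_def continuous_within)
  then obtain v where "u < v" "\<forall>r>u. r < v \<longrightarrow> \<omega> r = \<omega> u"
    unfolding tendsto_discrete by (auto simp: eventually_at_right_field)
  then show thesis
    by (intro that[of v]) (auto simp: le_less)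
qed

lemma counting_path_left_locally_constant:
  assumes "\<omega> \<in> counting_paths" "0 < u"
  obtains l v where "0 \<le> v" "v < u" "\<And>r. v < r \<Longrightarrow> r < u \<Longrightarrow> \<omega> r = l" "\<omega> u = l \<or> \<omega> u = l + 1"
proof -
  obtain l where l: "(\<omega> \<longlongrightarrow> l) (at_left u)" "\<omega> u = l \<or> \<omega> u = l + 1"
    using assms by (auto simp: counting_paths_def)
  then obtain v where "v < u" "\<forall>r>v. r < u \<longrightarrow> \<omega> r = l"
    unfolding tendsto_discrete by (auto simp: eventually_at_left_field)
  with l assms(2) show thesis
    by (intro that[of "max 0 v" l]) auto
qed

text \<open>
  Limits in a discrete space are eventually constant, so left limits and right-continuity amount to
  local constancy on either side.
\<close>

lemma counting_pathsI:
  assumes "\<And>r. r < 0 \<Longrightarrow> \<omega> r = undefined" "\<omega> 0 = 0"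
    and "\<And>u v. 0 \<le> u \<Longrightarrow> u \<le> v \<Longrightarrow> \<omega> u \<le> \<omega> v"
    and "\<And>u. 0 < u \<Longrightarrow> \<exists>v<u. \<exists>l. (\<forall>r. v < r \<and> r < u \<longrightarrow> \<omega> r = l) \<and> (\<omega> u = l \<or> \<omega> u = l + 1)"
    and "\<And>u. 0 \<le> u \<Longrightarrow> \<exists>v>u. \<forall>r. u \<le> r \<and> r < v \<longrightarrow> \<omega> r = \<omega> u"
  shows "\<omega> \<in> counting_paths"
  unfolding counting_paths_def
proof (intro CollectI conjI allI impI)
  show "\<omega> \<in> {0..} \<rightarrow>\<^sub>E UNIV"
    using assms(1) by (auto simp: PiE_def extensional_def)
  show "mono_on {0..} \<omega>"
    using assms(3) by (auto simp: mono_on_def)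
next
  fix u :: real assume "0 < u"
  then obtain v l where "v < u" "\<forall>r. v < r \<and> r < u \<longrightarrow> \<omega> r = l" "\<omega> u = l \<or> \<omega> u = l + 1"
    using assms(4) by meson
  then show "\<exists>l. (\<omega> \<longlongrightarrow> l) (at_left u) \<and> (\<omega> u = l \<or> \<omega> u = l + 1)"
    unfolding tendsto_discrete by (intro exI[of _ l]) (auto simp: eventually_at_left_field)
next
  fix u :: real assume "0 \<le> u"
  then obtain v where "u < v" "\<forall>r. u \<le> r \<and> r < v \<longrightarrow> \<omega> r = \<omega> u"
    using assms(5) by meson
  then have "(\<omega> \<longlongrightarrow> \<omega> u) (at_right u)"
    unfolding tendsto_discrete eventually_at_right_field by (meson less_imp_le)
  then show "continuous (at_right u) \<omega>"
    by (simp add: continuous_within)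
qed (use assms in auto)

text \<open>
  The continuation of \<open>\<omega>\<close> after \<open>T\<close> that has the value \<open>x i\<close> on the grid cell
  \<open>[T + i \<delta>, T + (i + 1) \<delta>[\<close>. With \<open>x 0 = \<omega> T\<close> it can jump only at grid points after \<open>T\<close>.
\<close>

definition splice_path :: "path \<Rightarrow> real \<Rightarrow> real \<Rightarrow> (nat \<Rightarrow> nat) \<Rightarrow> path" where
  "splice_path \<omega> T \<delta> x r = (if r \<le> T then \<omega> r else x (nat \<lfloor>(r - T) / \<delta>\<rfloor>))"

lemma grid_index:
  assumes "0 < \<delta>" "T + real i * \<delta> \<le> r" "r < T + real (Suc i) * \<delta>"
  shows "nat \<lfloor>(r - T) / \<delta>\<rfloor> = i"
proof -
  have "real i \<le> (r - T) / \<delta>" "(r - T) / \<delta> < real i + 1"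
    using assms by (auto simp: field_simps)
  then have "\<lfloor>(r - T) / \<delta>\<rfloor> = int i"
    by (intro floor_unique) auto
  then show ?thesis by simp
qed

lemma grid_index_exists:
  assumes "0 < \<delta>" "T \<le> r"
  obtains i where "T + real i * \<delta> \<le> r" "r < T + real (Suc i) * \<delta>"
proof -
  define i where "i = nat \<lfloor>(r - T) / \<delta>\<rfloor>"
  have "real i = of_int \<lfloor>(r - T) / \<delta>\<rfloor>"
    using assms by (simp add: i_def)
  then have "real i \<le> (r - T) / \<delta>" "(r - T) / \<delta> < real i + 1"
    by linarith+
  then show thesis
    using assms by (intro that[of i]) (auto simp: field_simps)
qed

lemma splice_path_before: "r \<le> T \<Longrightarrow> splice_path \<omega> T \<delta> x r = \<omega> r"
  by (simp add: splice_path_def)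

lemma splice_path_after:
  assumes "0 < \<delta>" "x 0 = \<omega> T" "T + real i * \<delta> \<le> r" "r < T + real (Suc i) * \<delta>"
  shows "splice_path \<omega> T \<delta> x r = x i"
proof (cases "r \<le> T")
  case True
  have "0 \<le> real i * \<delta>" using assms(1) by simp
  then have "real i * \<delta> = 0" "r = T" using True assms(3) by linarith+
  then show ?thesis using assms by (auto simp: splice_path_def)
next
  case False
  then show ?thesis using grid_index[OF assms(1,3,4)] by (simp add: splice_path_def)
qed

lemma splice_path_counting:
  assumes \<omega>: "\<omega> \<in> counting_paths" and T: "0 \<le> T" and \<delta>: "0 < \<delta>"
    and x0: "x 0 = \<omega> T" and x: "\<And>i. x (Suc i) = x i \<or> x (Suc i) = Suc (x i)"
  shows "splice_path \<omega> T \<delta> x \<in> counting_paths"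
proof (rule counting_pathsI)
  let ?\<omega> = "splice_path \<omega> T \<delta> x"
  note before = splice_path_before[of _ T \<omega> \<delta> x] and after = splice_path_after[of \<delta> x \<omega> T, OF \<delta> x0]
  have "mono x"
    unfolding mono_iff_le_Suc using x by (metis le_Suc_eq order_refl)
  show "?\<omega> 0 = 0"
    using before[of 0] T counting_path_start[OF \<omega>] by simp
  show "?\<omega> r = undefined" if "r < 0" for r
    using before[of r] that T PiE_arb[of \<omega> "{0..}" "\<lambda>_. UNIV" r] \<omega> by (simp add: counting_paths_def)
  show "?\<omega> u \<le> ?\<omega> v" if uv: "0 \<le> u" "u \<le> v" for u v
  proof -
    consider "v \<le> T" | "u \<le> T" "T < v" | "T < u" by linarith
    then show ?thesis
    proof cases
      case 1
      then show ?thesis using before counting_path_mono[OF \<omega> uv] uv by simp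
    next
      case 2
      then have "?\<omega> u \<le> x 0"
        using before x0 counting_path_mono[OF \<omega>, of u T] uv by simp
      also have "\<dots> \<le> ?\<omega> v"
        using 2 \<open>mono x\<close> by (simp add: splice_path_def monoD)
      finally show ?thesis .
    next
      case 3
      have "nat \<lfloor>(u - T) / \<delta>\<rfloor> \<le> nat \<lfloor>(v - T) / \<delta>\<rfloor>"
        using uv \<delta> by (intro nat_mono floor_mono divide_right_mono) auto
      then show ?thesis
        using 3 uv \<open>mono x\<close> by (simp add: splice_path_def monoD)
    qed
  qed
  show "\<exists>v>u. \<forall>r. u \<le> r \<and> r < v \<longrightarrow> ?\<omega> r = ?\<omega> u" if u: "0 \<le> u" for u
  proof (cases "u < T")
    case True
    obtain v where v: "u < v" "\<And>r. u \<le> r \<Longrightarrow> r < v \<Longrightarrow> \<omega> r = \<omega> u"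
      using counting_path_right_locally_constant[OF \<omega> u] by blast
    have "?\<omega> r = ?\<omega> u" if "u \<le> r" "r < min v T" for r
      using before[of r] before[of u] v(2)[of r] that True by simp
    moreover have "u < min v T" using True v(1) by simp
    ultimately show ?thesis by blast
  next
    case False
    then obtain i where i: "T + real i * \<delta> \<le> u" "u < T + real (Suc i) * \<delta>"
      using grid_index_exists[OF \<delta>, of T u] by auto
    then show ?thesis
      using after[of i] by (intro exI[of _ "T + real (Suc i) * \<delta>"]) auto
  qed
  show "\<exists>v<u. \<exists>l. (\<forall>r. v < r \<and> r < u \<longrightarrow> ?\<omega> r = l) \<and> (?\<omega> u = l \<or> ?\<omega> u = l + 1)" if u: "0 < u" for u
  proof (cases "u \<le> T")
    case True
    obtain l v where "v < u" "\<And>r. v < r \<Longrightarrow> r < u \<Longrightarrow> \<omega> r = l" "\<omega> u = l \<or> \<omega> u = l + 1"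
      using counting_path_left_locally_constant[OF \<omega> u] by blast
    then show ?thesis
      using True before by (intro exI[of _ v] exI[of _ l] conjI) auto
  next
    case False
    then obtain i where i: "T + real i * \<delta> \<le> u" "u < T + real (Suc i) * \<delta>"
      using grid_index_exists[OF \<delta>, of T u] by auto
    show ?thesis
    proof (cases "T + real i * \<delta> = u")
      case True
      \<comment> \<open>A grid point: the left limit is the value on the preceding grid cell.\<close>
      with False obtain j where j: "i = Suc j"
        by (cases i) auto
      have "?\<omega> r = x j" if "T + real j * \<delta> < r" "r < u" for r
        using that True j by (intro after) auto
      moreover have "?\<omega> u = x (Suc j)"
        using i j after by simp
      moreover have "T + real j * \<delta> < u"
        using True j \<delta> by (simp add: algebra_simps)
      ultimately show ?thesis
        using x[of j] by (intro exI[of _ "T + real j * \<delta>"] exI[of _ "x j"]) auto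
    next
      case False
      then show ?thesis
        using i after[of i] by (intro exI[of _ "T + real i * \<delta>"] exI[of _ "x i"]) auto
    qed
  qed
qed


section \<open>Stopping times and trading gains\<close>

text \<open>
  The gain between \<open>u\<close> and \<open>v\<close> from the constant stakes \<open>p\<close> on jumps exceeding the rate \<open>hi\<close> and \<open>q\<close>
  on jumps falling short of the rate \<open>lo\<close>.
\<close>

definition trade_gain :: "real \<Rightarrow> real \<Rightarrow> real \<Rightarrow> real \<Rightarrow> path \<Rightarrow> real \<Rightarrow> real \<Rightarrow> real" where
  "trade_gain lo hi p q \<omega> u v =
     p * (real (\<omega> v) - real (\<omega> u) - hi * (v - u)) + q * (lo * (v - u) - real (\<omega> v) + real (\<omega> u))"

lemma trade_gain_same [simp]: "trade_gain lo hi p q \<omega> u u = 0"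
  by (simp add: trade_gain_def)

lemma trade_gain_zero [simp]: "trade_gain lo hi 0 0 \<omega> u v = 0"
  by (simp add: trade_gain_def)

lemma trade_gain_add:
  "trade_gain lo hi p q \<omega> u v + trade_gain lo hi p q \<omega> v w = trade_gain lo hi p q \<omega> u w"
  by (simp add: trade_gain_def algebra_simps)

lemma stop_at_before: "0 \<le> r \<Longrightarrow> ennreal r \<le> \<tau> \<omega> \<Longrightarrow> stop_at \<tau> r \<omega> = r"
  by (simp add: stop_at_def min_def)

lemma stop_at_after: "\<tau> \<omega> \<le> ennreal r \<Longrightarrow> stop_at \<tau> r \<omega> = enn2real (\<tau> \<omega>)"
  by (simp add: stop_at_def min_def)

lemma stop_at_bounds:
  assumes "0 \<le> r"
  shows "0 \<le> stop_at \<tau> r \<omega>" "stop_at \<tau> r \<omega> \<le> r"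
proof -
  show "0 \<le> stop_at \<tau> r \<omega>" by (simp add: stop_at_def)
  have "enn2real (min (\<tau> \<omega>) (ennreal r)) \<le> enn2real (ennreal r)"
    by (intro enn2real_mono) auto
  then show "stop_at \<tau> r \<omega> \<le> r" using assms by (simp add: stop_at_def)
qed

lemma agree_upto_sym: "agree_upto T \<omega>1 \<omega>2 \<Longrightarrow> agree_upto T \<omega>2 \<omega>1"
  by (simp add: agree_upto_def)

lemma agree_upto_trans: "agree_upto T \<omega>1 \<omega>2 \<Longrightarrow> agree_upto T \<omega>2 \<omega>3 \<Longrightarrow> agree_upto T \<omega>1 \<omega>3"
  by (simp add: agree_upto_def)

lemma agree_upto_le: "agree_upto T \<omega>1 \<omega>2 \<Longrightarrow> T' \<le> T \<Longrightarrow> agree_upto T' \<omega>1 \<omega>2"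
  by (auto simp: agree_upto_def)

lemma agree_uptoD: "agree_upto (ennreal T) \<omega>1 \<omega>2 \<Longrightarrow> 0 \<le> r \<Longrightarrow> r \<le> T \<Longrightarrow> \<omega>1 r = \<omega>2 r"
  by (auto simp: agree_upto_def ennreal_leI)

lemma agree_uptoI: "0 \<le> T \<Longrightarrow> (\<And>r. 0 \<le> r \<Longrightarrow> r \<le> T \<Longrightarrow> \<omega>1 r = \<omega>2 r) \<Longrightarrow> agree_upto (ennreal T) \<omega>1 \<omega>2"
  by (auto simp: agree_upto_def)

lemma stopping_time_eq:
  assumes "stopping_time \<tau>" "\<omega>1 \<in> counting_paths" "\<omega>2 \<in> counting_paths" "agree_upto T \<omega>1 \<omega>2" "\<tau> \<omega>1 \<le> T"
  shows "\<tau> \<omega>2 = \<tau> \<omega>1"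
  using assms agree_upto_le[OF assms(4,5)] unfolding stopping_time_def by metis

lemma stopping_time_const: "stopping_time (\<lambda>_. T)"
  by (simp add: stopping_time_def)

lemma stop_at_agree:
  assumes "stopping_time \<tau>" "\<omega>1 \<in> counting_paths" "\<omega>2 \<in> counting_paths" "agree_upto (ennreal r) \<omega>1 \<omega>2"
  shows "stop_at \<tau> r \<omega>1 = stop_at \<tau> r \<omega>2"
proof (cases "\<tau> \<omega>1 \<le> ennreal r \<or> \<tau> \<omega>2 \<le> ennreal r")
  case True
  then have "\<tau> \<omega>1 = \<tau> \<omega>2"
    using stopping_time_eq assms agree_upto_sym by metis
  then show ?thesis by (simp add: stop_at_def)
next
  case False
  then show ?thesis by (simp add: stop_at_def min_def)
qed

lemma capital_eq_sum_trade_gain: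
  "capital lo hi n \<tau> hu hl c r \<omega> = c + (\<Sum>k=1..n.
     trade_gain lo hi (the (hu k \<omega>)) (the (hl k \<omega>)) \<omega> (stop_at (\<tau> k) r \<omega>) (stop_at (\<tau> (Suc k)) r \<omega>))"
  unfolding capital_def trade_gain_def Let_def
  by (intro arg_cong[where f = "\<lambda>x. c + x"] sum.cong) auto


section \<open>A deterministic adversary\<close>

text \<open>
  What \<open>g (N\<^sub>t)\<close> is worth at time \<open>r\<close>; after \<open>t\<close> the payoff is settled and the value is constant.
\<close>

definition path_value :: "real \<Rightarrow> real \<Rightarrow> (nat \<Rightarrow>\<^sub>C real) \<Rightarrow> real \<Rightarrow> real \<Rightarrow> path \<Rightarrow> real" where
  "path_value lo hi g t r \<omega> = apply_bcontfun (poisson_semigroup lo hi (max 0 (t - r)) g) (\<omega> (min r t))"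

lemma path_value_after:
  assumes "0 \<le> lo" "lo \<le> hi" "t \<le> r"
  shows "path_value lo hi g t r \<omega> = apply_bcontfun g (\<omega> t)"
  using assms by (simp add: path_value_def semigroup_zero_time)

text \<open>
  If a jump had probability \<open>\<delta> l\<close> with \<open>l\<close> attaining the maximum in the Euler step, then \<open>f\<close> would
  have the Euler step as its mean, while both stakes would have nonpositive mean gain because
  \<open>lo \<le> l \<le> hi\<close>. The better of jumping and staying is at least as good for the adversary as this mean.
\<close>

lemma adversary_step:
  assumes "0 \<le> lo" "lo \<le> hi" "0 \<le> p" "0 \<le> q" "0 \<le> \<delta>" "\<delta> * hi \<le> 1"
  shows "\<exists>m'. (m' = m \<or> m' = Suc m) \<and>
    p * (real m' - real m - hi * \<delta>) + q * (lo * \<delta> - real m' + real m)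
      \<le> apply_bcontfun f m' - apply_bcontfun (euler_step lo hi \<delta> f) m"
proof -
  let ?E = "apply_bcontfun (euler_step lo hi \<delta> f) m"
  let ?A = "apply_bcontfun f m + p * hi * \<delta> - q * lo * \<delta>"
  let ?B = "apply_bcontfun f (Suc m) - p * (1 - hi * \<delta>) - q * (lo * \<delta> - 1)"
  have "?E \<in> (\<lambda>l. (1 - \<delta> * l) * apply_bcontfun f m + \<delta> * l * apply_bcontfun f (m + 1)) ` {lo, hi}"
    unfolding apply_euler_step[OF assms(5)] by (rule Max_in) auto
  then obtain l where l: "l \<in> {lo, hi}"
    and E: "?E = (1 - \<delta> * l) * apply_bcontfun f m + \<delta> * l * apply_bcontfun f (Suc m)"
    by auto
  have w: "0 \<le> \<delta> * l" "\<delta> * l \<le> 1"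
    using l assms mult_left_mono[of lo hi \<delta>] by auto
  \<comment> \<open>A mean of the two outcomes is at least the Euler step, so one of them is.\<close>
  have "(1 - \<delta> * l) * ?A + \<delta> * l * ?B = ?E + p * \<delta> * (hi - l) + q * \<delta> * (l - lo)"
    unfolding E by (simp add: algebra_simps)
  moreover have "0 \<le> p * \<delta> * (hi - l) + q * \<delta> * (l - lo)"
    using l assms by auto
  ultimately have mean: "?E \<le> (1 - \<delta> * l) * ?A + \<delta> * l * ?B" by linarith
  have "?E \<le> ?A \<or> ?E \<le> ?B"
  proof (rule ccontr)
    assume "\<not> (?E \<le> ?A \<or> ?E \<le> ?B)"
    then have lt: "max ?A ?B < ?E" by simp
    have "(1 - \<delta> * l) * ?A + \<delta> * l * ?B \<le> (1 - \<delta> * l) * max ?A ?B + \<delta> * l * max ?A ?B"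
      using w by (intro add_mono mult_left_mono) auto
    also have "\<dots> = max ?A ?B" by (simp add: algebra_simps)
    finally show False using mean lt by linarith
  qed
  then show ?thesis
  proof
    assume "?E \<le> ?A" then show ?thesis
      by (intro exI[of _ m]) (simp add: algebra_simps)
  next
    assume "?E \<le> ?B" then show ?thesis
      by (intro exI[of _ "Suc m"]) (simp add: algebra_simps)
  qed
qed

text \<open>
  Iterating \<open>adversary_step\<close> along the grid: up to step \<open>k\<close> the gain is at most the increase in
  the value function, and from then on it does not grow any more.
\<close>

lemma adversary_walk:
  assumes "0 \<le> lo" "lo \<le> hi" "0 \<le> p" "0 \<le> q" "0 \<le> \<delta>" "\<delta> * hi \<le> 1"
  obtains x :: "nat \<Rightarrow> nat" where "x 0 = m" "\<And>i. x (Suc i) = x i \<or> x (Suc i) = Suc (x i)"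
    "\<And>i. p * (real (x i) - real m - hi * (real i * \<delta>)) + q * (lo * (real i * \<delta>) - real (x i) + real m)
      \<le> apply_bcontfun ((euler_step lo hi \<delta> ^^ (k - i)) g) (x (min i k))
        - apply_bcontfun ((euler_step lo hi \<delta> ^^ k) g) m"
proof -
  let ?f = "\<lambda>i. (euler_step lo hi \<delta> ^^ (k - i)) g"
  let ?G = "\<lambda>n n' s. p * (real n' - real n - hi * s) + q * (lo * s - real n' + real n)"
  \<comment> \<open>After step \<open>k\<close> the walk only has to keep the trading gain from growing, which is the
    step for the zero function.\<close>
  let ?h = "\<lambda>i. if i < k then ?f (Suc i) else 0"
  have "\<exists>x. \<forall>i. (i = 0 \<longrightarrow> x i = m) \<and> ((x (Suc i) = x i \<or> x (Suc i) = Suc (x i)) \<and>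
      ?G (x i) (x (Suc i)) \<delta>
        \<le> apply_bcontfun (?h i) (x (Suc i)) - apply_bcontfun (euler_step lo hi \<delta> (?h i)) (x i))"
    using adversary_step[OF assms]
    by (intro dependent_nat_choice[where P = "\<lambda>i n. i = 0 \<longrightarrow> n = m"]) auto
  then obtain x where x0: "x 0 = m" and x: "\<And>i. x (Suc i) = x i \<or> x (Suc i) = Suc (x i)"
    and step: "\<And>i. ?G (x i) (x (Suc i)) \<delta>
        \<le> apply_bcontfun (?h i) (x (Suc i)) - apply_bcontfun (euler_step lo hi \<delta> (?h i)) (x i)"
    by blast
  have "?G m (x i) (real i * \<delta>) \<le> apply_bcontfun (?f i) (x (min i k)) - apply_bcontfun (?f 0) m" for i
  proof (induction i)
    case 0
    then show ?case by (simp add: x0)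
  next
    case (Suc i)
    have "apply_bcontfun (?h i) (x (Suc i)) - apply_bcontfun (euler_step lo hi \<delta> (?h i)) (x i)
      = apply_bcontfun (?f (Suc i)) (x (min (Suc i) k)) - apply_bcontfun (?f i) (x (min i k))"
    proof (cases "i < k")
      case True
      then have "euler_step lo hi \<delta> (?f (Suc i)) = ?f i"
        by (simp add: Suc_diff_Suc flip: funpow.simps(2)[unfolded o_def, THEN fun_cong] funpow_Suc_right)
      then show ?thesis using True by (simp add: min_def)
    next
      case False
      then show ?thesis
        by (simp add: min_def euler_step_def poisson_generator_zero[OF assms(1,2)])
    qed
    moreover have "?G m (x (Suc i)) (real (Suc i) * \<delta>) = ?G m (x i) (real i * \<delta>) + ?G (x i) (x (Suc i)) \<delta>"
      by (simp add: algebra_simps)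
    ultimately show ?case using Suc step[of i] by linarith
  qed
  then show thesis using that x0 x by simp
qed

lemma grid_mesh_exists:
  fixes D \<delta>\<^sub>0 :: real
  assumes "0 \<le> D" "0 < \<delta>\<^sub>0"
  obtains k \<delta> where "0 < \<delta>" "\<delta> \<le> \<delta>\<^sub>0" "real k * \<delta> = D"
proof (cases "D = 0")
  case True
  then show ?thesis using that[of \<delta>\<^sub>0 0] assms by simp
next
  case False
  obtain k :: nat where k: "D / \<delta>\<^sub>0 \<le> real k" using real_arch_simple by blast
  with False assms have "0 < real k"
    by (metis divide_pos_pos less_le order.strict_trans2)
  then show ?thesis
    using that[of "D / real k" k] k False assms by (simp add: field_simps)
qed

text \<open>
  Against stakes that stay constant from \<open>T\<close> on, the walk on a fine grid provides one path that is
  good at all later times at once. The error does not grow with \<open>r\<close>: it consists of the Euler error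
  at two times and of the drift within a single grid cell. The bound thus survives whatever later
  time is chosen as the end of the leg.
\<close>

lemma adversary_continuation:
  assumes rates: "0 \<le> lo" "lo \<le> hi" and pq: "0 \<le> p" "0 \<le> q"
    and \<omega>: "\<omega> \<in> counting_paths" and T: "0 \<le> T" and \<epsilon>: "0 < \<epsilon>"
  obtains \<omega>' where "\<omega>' \<in> counting_paths" "\<And>r. r \<le> T \<Longrightarrow> \<omega>' r = \<omega> r"
    "\<And>r. T \<le> r \<Longrightarrow> trade_gain lo hi p q \<omega>' T r
        \<le> path_value lo hi g t r \<omega>' - path_value lo hi g t T \<omega>' + \<epsilon>"
proof -
  define D where "D = max 0 (t - T)"
  \<comment> \<open>The error of the construction is \<open>\<delta> C\<close>: twice the distance between value function and
    Euler scheme, and the drift within a cell.\<close>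
  define C where "C = 2 * (2 * hi * norm g + D * ((2 * hi)\<^sup>2 * norm g)) + q * lo"
  have nn: "0 \<le> hi" "0 \<le> D" "0 \<le> C"
    using rates pq by (auto simp: D_def C_def)
  have "0 < min (1 / (hi + 1)) (\<epsilon> / (C + 1))"
    using nn \<epsilon> by simp
  then obtain k \<delta> where \<delta>: "0 < \<delta>" "\<delta> \<le> min (1 / (hi + 1)) (\<epsilon> / (C + 1))" and k: "real k * \<delta> = D"
    using grid_mesh_exists[OF nn(2)] by blast
  have "\<delta> * (hi + 1) \<le> 1" "\<delta> * (C + 1) \<le> \<epsilon>"
    using \<delta> nn by (simp_all add: field_simps)
  then have \<delta>hi: "\<delta> * hi \<le> 1" and \<delta>C: "\<delta> * C \<le> \<epsilon>"
    using \<delta> by (simp_all add: algebra_simps)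
  obtain x :: "nat \<Rightarrow> nat" where x0: "x 0 = \<omega> T"
    and x: "\<And>i. x (Suc i) = x i \<or> x (Suc i) = Suc (x i)"
    and gain: "\<And>i. p * (real (x i) - real (\<omega> T) - hi * (real i * \<delta>))
        + q * (lo * (real i * \<delta>) - real (x i) + real (\<omega> T))
      \<le> apply_bcontfun ((euler_step lo hi \<delta> ^^ (k - i)) g) (x (min i k))
        - apply_bcontfun ((euler_step lo hi \<delta> ^^ k) g) (\<omega> T)"
    using adversary_walk[OF rates pq less_imp_le[OF \<delta>(1)] \<delta>hi] by metis
  define \<omega>' where "\<omega>' = splice_path \<omega> T \<delta> x"
  note after = splice_path_after[of \<delta> x \<omega> T, OF \<delta>(1) x0, folded \<omega>'_def]
  let ?f = "\<lambda>i. (euler_step lo hi \<delta> ^^ (k - i)) g"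
  let ?V = "\<lambda>r. path_value lo hi g t r \<omega>'"
  show thesis
  proof (rule that)
    show "\<omega>' \<in> counting_paths"
      unfolding \<omega>'_def by (rule splice_path_counting[OF \<omega> T \<delta>(1) x0 x])
    show "\<omega>' r = \<omega> r" if "r \<le> T" for r
      unfolding \<omega>'_def by (rule splice_path_before[OF that])
    fix r assume r: "T \<le> r"
    obtain i where i: "T + real i * \<delta> \<le> r" "r < T + real (Suc i) * \<delta>"
      using grid_index_exists[OF \<delta>(1) r] by blast
    \<comment> \<open>Between grid points only the drift of the short position can contribute a gain.\<close>
    have "trade_gain lo hi p q \<omega>' T r
        = p * (real (x i) - real (\<omega> T) - hi * (real i * \<delta>)) + q * (lo * (real i * \<delta>) - real (x i) + real (\<omega> T))
          + (q * lo - p * hi) * (r - (T + real i * \<delta>))"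
    proof -
      have a: "\<omega>' r = x i" "\<omega>' T = \<omega> T"
        using after[OF i] after[of 0 T] \<delta>(1) x0 by simp_all
      show ?thesis unfolding trade_gain_def a by (simp add: algebra_simps)
    qed
    moreover have "(q * lo - p * hi) * (r - (T + real i * \<delta>)) \<le> q * lo * \<delta>"
      using i pq rates by (intro mult_mono) (auto simp: algebra_simps)
    ultimately have 1: "trade_gain lo hi p q \<omega>' T r
        \<le> apply_bcontfun (?f i) (x (min i k)) - apply_bcontfun (?f 0) (\<omega> T) + q * lo * \<delta>"
      using gain[of i] by simp
    show "trade_gain lo hi p q \<omega>' T r \<le> ?V r - ?V T + \<epsilon>"
    proof (cases "T \<le> t")
      case False
      then have "k = 0" using k \<delta> by (simp add: D_def)
      then have "trade_gain lo hi p q \<omega>' T r \<le> q * lo * \<delta>" using 1 x0 by simp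
      also have "\<dots> \<le> \<delta> * C"
        using nn \<delta> rates by (simp add: C_def algebra_simps)
      also have "\<dots> \<le> \<epsilon>" by (rule \<delta>C)
      finally show ?thesis
        using False r path_value_after[OF rates] by simp
    next
      case True
      then have kD: "real k * \<delta> = t - T" using k by (simp add: D_def)
      let ?C' = "2 * hi * norm g + D * ((2 * hi)\<^sup>2 * norm g)"
      have approx: "\<bar>?V r - apply_bcontfun (?f i) (x (min i k))\<bar> \<le> \<delta> * ?C'"
        if i: "T + real i * \<delta> \<le> r" "r < T + real (Suc i) * \<delta>" for r i
      proof (cases "r < t")
        case False
        have "\<omega>' t = x k"
          using kD \<delta> by (intro after) (auto simp: algebra_simps)
        moreover have "k \<le> i"
        proof -
          have "real k * \<delta> < real (Suc i) * \<delta>" using False i kD by linarith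
          then show ?thesis using \<delta> by simp
        qed
        ultimately have "?V r = apply_bcontfun (?f i) (x (min i k))"
          using False path_value_after[OF rates, of t r g \<omega>'] by simp
        then show ?thesis using nn \<delta> by simp
      next
        case rt: True
        have "i < k"
        proof -
          have "real i * \<delta> < real k * \<delta>" using rt i kD by linarith
          then show ?thesis using \<delta> by simp
        qed
        have ki: "real (k - i) * \<delta> = t - (T + real i * \<delta>)"
          using \<open>i < k\<close> kD by (simp add: of_nat_diff algebra_simps)
        have "norm (?f i - poisson_semigroup lo hi (real (k - i) * \<delta>) g)
            \<le> real (k - i) * \<delta> * \<delta> * ((2 * hi)\<^sup>2 * norm g)"
          using \<delta> by (intro euler_power_approximates_semigroup rates \<delta>hi) auto
        also have "\<dots> \<le> \<delta> * (D * ((2 * hi)\<^sup>2 * norm g))"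
        proof -
          have "real (k - i) * \<delta> \<le> D"
            unfolding k[symmetric] using \<delta> by (intro mult_right_mono) auto
          then have "real (k - i) * \<delta> * (\<delta> * ((2 * hi)\<^sup>2 * norm g)) \<le> D * (\<delta> * ((2 * hi)\<^sup>2 * norm g))"
            using \<delta> by (intro mult_right_mono) auto
          then show ?thesis by (simp add: mult_ac)
        qed
        finally have a: "norm (?f i - poisson_semigroup lo hi (real (k - i) * \<delta>) g)
            \<le> \<delta> * (D * ((2 * hi)\<^sup>2 * norm g))" .
        have "norm (poisson_semigroup lo hi (t - r) g - poisson_semigroup lo hi (real (k - i) * \<delta>) g)
            \<le> \<bar>t - r - real (k - i) * \<delta>\<bar> * (2 * hi * norm g)"
          using \<delta> rt by (intro semigroup_time_lipschitz rates) auto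
        also have "\<dots> \<le> \<delta> * (2 * hi * norm g)"
        proof (rule mult_right_mono)
          have "real (Suc i) * \<delta> = real i * \<delta> + \<delta>" by (simp add: algebra_simps)
          then show "\<bar>t - r - real (k - i) * \<delta>\<bar> \<le> \<delta>"
            using i unfolding ki by linarith
        qed (use nn in auto)
        finally have b: "norm (poisson_semigroup lo hi (t - r) g - poisson_semigroup lo hi (real (k - i) * \<delta>) g)
            \<le> \<delta> * (2 * hi * norm g)" .
        have "norm (poisson_semigroup lo hi (t - r) g - ?f i)
            \<le> \<delta> * (2 * hi * norm g) + \<delta> * (D * ((2 * hi)\<^sup>2 * norm g))"
          using norm_diff_triangle_le[OF b, of "?f i"] a by (simp add: norm_minus_commute)
        then have "\<bar>apply_bcontfun (poisson_semigroup lo hi (t - r) g - ?f i) (x i)\<bar> \<le> \<delta> * ?C'"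
          using norm_bounded[of "poisson_semigroup lo hi (t - r) g - ?f i" "x i"]
          by (simp add: algebra_simps)
        moreover have "\<omega>' r = x i" by (rule after[OF i])
        ultimately show ?thesis
          using rt \<open>i < k\<close> by (simp add: path_value_def)
      qed
      have "\<bar>?V r - apply_bcontfun (?f i) (x (min i k))\<bar> \<le> \<delta> * ?C'"
        by (rule approx[OF i])
      moreover have "\<bar>?V T - apply_bcontfun (?f 0) (\<omega> T)\<bar> \<le> \<delta> * ?C'"
        using approx[of 0 T] \<delta> x0 by simp
      moreover have "\<delta> * ?C' + \<delta> * ?C' + q * lo * \<delta> = \<delta> * C"
        by (simp add: C_def algebra_simps)
      ultimately show ?thesis using 1 \<delta>C by linarith
    qed
  qed
qed

text \<open>
  A trading strategy with a leg for every natural number. Any strategy can be brought into this form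
  by idle legs before its first and after its last stopping time, so that a single induction over
  legs also covers these two periods.
\<close>

locale trading_sequence =
  fixes lo hi :: real
    and \<tau> :: "nat \<Rightarrow> path \<Rightarrow> ennreal" and p q :: "nat \<Rightarrow> path \<Rightarrow> real"
  assumes rates: "0 \<le> lo" "lo \<le> hi"
    and stopping: "\<And>j. stopping_time (\<tau> j)"
    and start: "\<And>\<omega>. \<tau> 0 \<omega> = 0"
    and increasing: "\<And>j \<omega>. \<omega> \<in> counting_paths \<Longrightarrow> \<tau> j \<omega> \<le> \<tau> (Suc j) \<omega>"
    and nonneg: "\<And>j \<omega>. \<omega> \<in> counting_paths \<Longrightarrow> \<tau> j \<omega> < \<infinity> \<Longrightarrow> 0 \<le> p j \<omega> \<and> 0 \<le> q j \<omega>"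
    and measurable: "\<And>j \<omega>1 \<omega>2. \<omega>1 \<in> counting_paths \<Longrightarrow> \<omega>2 \<in> counting_paths \<Longrightarrow> \<tau> j \<omega>1 < \<infinity> \<Longrightarrow>
      agree_upto (\<tau> j \<omega>1) \<omega>1 \<omega>2 \<Longrightarrow> p j \<omega>2 = p j \<omega>1 \<and> q j \<omega>2 = q j \<omega>1"
begin

definition leg :: "nat \<Rightarrow> real \<Rightarrow> path \<Rightarrow> real" where
  "leg j r \<omega> = trade_gain lo hi (p j \<omega>) (q j \<omega>) \<omega> (stop_at (\<tau> j) r \<omega>) (stop_at (\<tau> (Suc j)) r \<omega>)"

definition total_gain :: "nat \<Rightarrow> real \<Rightarrow> path \<Rightarrow> real" where
  "total_gain m r \<omega> = (\<Sum>j<m. leg j r \<omega>)"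

lemma leg_zero_before:
  assumes "\<omega> \<in> counting_paths" "0 \<le> r" "ennreal r \<le> \<tau> j \<omega>"
  shows "leg j r \<omega> = 0"
proof -
  have "ennreal r \<le> \<tau> (Suc j) \<omega>"
    using assms(3) increasing[OF assms(1)] by (rule order.trans)
  then show ?thesis
    unfolding leg_def using assms by (simp add: stop_at_before)
qed

text \<open>
  The stakes are known when the leg begins, so the gain up to time \<open>r\<close> is a function of the path up
  to time \<open>r\<close>.
\<close>

lemma leg_agree:
  assumes "\<omega>1 \<in> counting_paths" "\<omega>2 \<in> counting_paths" "0 \<le> r" "agree_upto (ennreal r) \<omega>1 \<omega>2"
  shows "leg j r \<omega>1 = leg j r \<omega>2"
proof (cases "\<tau> j \<omega>1 \<le> ennreal r")
  case True
  then have "\<tau> j \<omega>1 < \<infinity>"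
    using le_less_trans[OF True ennreal_less_top] by simp
  then have "p j \<omega>2 = p j \<omega>1 \<and> q j \<omega>2 = q j \<omega>1"
    using measurable[OF assms(1,2)] agree_upto_le[OF assms(4) True] by blast
  moreover have "\<omega>1 (stop_at \<sigma> r \<omega>2) = \<omega>2 (stop_at \<sigma> r \<omega>2)" for \<sigma>
    using stop_at_bounds[OF assms(3)] by (intro agree_uptoD[OF assms(4)])
  ultimately show ?thesis
    unfolding leg_def trade_gain_def stop_at_agree[OF stopping assms(1,2,4)] by simp
next
  case False
  then have "\<not> \<tau> j \<omega>2 \<le> ennreal r"
    using stopping_time_eq[OF stopping assms(2,1) agree_upto_sym[OF assms(4)]] by metis
  then show ?thesis
    using False assms by (simp add: leg_zero_before)
qed

lemma total_gain_agree:
  assumes "\<omega>1 \<in> counting_paths" "\<omega>2 \<in> counting_paths" "0 \<le> r" "agree_upto (ennreal r) \<omega>1 \<omega>2"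
  shows "total_gain m r \<omega>1 = total_gain m r \<omega>2"
  unfolding total_gain_def by (rule sum.cong[OF refl leg_agree[OF assms]])

lemma total_gain_constant_after:
  assumes \<omega>: "\<omega> \<in> counting_paths" and T: "\<tau> m \<omega> \<le> ennreal T" "T \<le> r"
  shows "total_gain m r \<omega> = total_gain m T \<omega>"
proof -
  have "stop_at (\<tau> i) r \<omega> = stop_at (\<tau> i) T \<omega>" if "i \<le> m" for i
  proof -
    have "\<tau> i \<omega> \<le> \<tau> m \<omega>"
      by (rule lift_Suc_mono_le[of "\<lambda>i. \<tau> i \<omega>", OF increasing[OF \<omega>] that])
    then show ?thesis
      using T by (simp add: stop_at_after ennreal_leI order.trans)
  qed
  then show ?thesis
    unfolding total_gain_def leg_def by (intro sum.cong) auto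
qed

text \<open>
  Induction over the legs. The path for the first \<open>m\<close> legs is followed until \<open>T\<close>, the later of \<open>s\<close> and
  the beginning of leg \<open>m\<close>. There the stakes of leg \<open>m\<close> are known, and
  \<open>adversary_continuation\<close> against these stakes supplies the rest of the path. As the new path agrees
  with the old one up to \<open>T\<close>, stopping times that occurred by then, stakes and past gains are unchanged.
\<close>

lemma adversary_path:
  assumes \<omega>: "\<omega> \<in> counting_paths" and s: "0 \<le> s" and \<epsilon>: "0 < \<epsilon>"
  shows "\<exists>\<omega>'\<in>counting_paths. agree_upto (ennreal s) \<omega> \<omega>' \<and>
    (\<forall>r\<ge>s. ennreal r \<le> max (ennreal s) (\<tau> m \<omega>') \<longrightarrow>
      total_gain m r \<omega>' - total_gain m s \<omega>'
        \<le> path_value lo hi g t r \<omega>' - path_value lo hi g t s \<omega>' + real m * \<epsilon>)"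
proof (induction m)
  case 0
  have only_s: "r = s" if "s \<le> r" "ennreal r \<le> max (ennreal s) (\<tau> 0 \<omega>)" for r
    using that s by (simp add: start max_absorb1)
  show ?case
  proof (intro bexI conjI allI impI)
    fix r assume "s \<le> r" "ennreal r \<le> max (ennreal s) (\<tau> 0 \<omega>)"
    then have "r = s" by (rule only_s)
    then show "total_gain 0 r \<omega> - total_gain 0 s \<omega>
        \<le> path_value lo hi g t r \<omega> - path_value lo hi g t s \<omega> + real 0 * \<epsilon>" by simp
  qed (use \<omega> in \<open>auto simp: agree_upto_def\<close>)
next
  case (Suc m)
  then obtain \<omega>1 where \<omega>1: "\<omega>1 \<in> counting_paths" "agree_upto (ennreal s) \<omega> \<omega>1"
    and IH: "\<And>r. s \<le> r \<Longrightarrow> ennreal r \<le> max (ennreal s) (\<tau> m \<omega>1) \<Longrightarrow>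
      total_gain m r \<omega>1 - total_gain m s \<omega>1
        \<le> path_value lo hi g t r \<omega>1 - path_value lo hi g t s \<omega>1 + real m * \<epsilon>"
    by blast
  show ?case
  proof (cases "\<tau> m \<omega>1 = \<infinity>")
    case True
    \<comment> \<open>No trading takes place in this leg along \<open>\<omega>1\<close>.\<close>
    have "total_gain (Suc m) r \<omega>1 = total_gain m r \<omega>1" if "s \<le> r" for r
      using that s True \<omega>1 by (simp add: total_gain_def leg_zero_before)
    moreover have "total_gain m r \<omega>1 - total_gain m s \<omega>1
        \<le> path_value lo hi g t r \<omega>1 - path_value lo hi g t s \<omega>1 + real (Suc m) * \<epsilon>" if "s \<le> r" for r
    proof -
      have "ennreal r \<le> max (ennreal s) (\<tau> m \<omega>1)" using True by simp
      moreover have "real m * \<epsilon> \<le> real (Suc m) * \<epsilon>" using \<epsilon> by simp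
      ultimately show ?thesis using IH[OF that] by linarith
    qed
    ultimately show ?thesis
      using \<omega>1 by (intro bexI[of _ \<omega>1]) auto
  next
    case False
    then obtain u where u: "0 \<le> u" "\<tau> m \<omega>1 = ennreal u"
      by (cases "\<tau> m \<omega>1") auto
    define T where "T = max s u"
    have T: "0 \<le> T" "s \<le> T" "u \<le> T" "T = s \<or> T = u"
      using s by (auto simp: T_def)
    have T_max: "max (ennreal s) (\<tau> m \<omega>1) = ennreal T"
      using s u by (simp add: T_def max_def)
    obtain \<omega>2 where \<omega>2: "\<omega>2 \<in> counting_paths" and eq: "\<And>r. r \<le> T \<Longrightarrow> \<omega>2 r = \<omega>1 r"
      and gain: "\<And>r. T \<le> r \<Longrightarrow> trade_gain lo hi (p m \<omega>1) (q m \<omega>1) \<omega>2 T r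
        \<le> path_value lo hi g t r \<omega>2 - path_value lo hi g t T \<omega>2 + \<epsilon>"
      using adversary_continuation[OF rates _ _ \<omega>1(1) T(1) \<epsilon>, of "p m \<omega>1" "q m \<omega>1" g t] nonneg[OF \<omega>1(1), of m] u
      by (metis ennreal_less_top infinity_ennreal_def)
    have agree: "agree_upto (ennreal r) \<omega>1 \<omega>2" if "0 \<le> r" "r \<le> T" for r
      using that eq by (intro agree_uptoI) auto
    have \<tau>2: "\<tau> m \<omega>2 = ennreal u"
      using stopping_time_eq[OF stopping \<omega>1(1) \<omega>2 agree[OF T(1)]] u T by (simp add: ennreal_leI)
    have pq: "p m \<omega>2 = p m \<omega>1" "q m \<omega>2 = q m \<omega>1"
      using measurable[OF \<omega>1(1) \<omega>2, of m] agree[OF u(1) T(3)] u by simp_all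
    have value_eq: "path_value lo hi g t r \<omega>2 = path_value lo hi g t r \<omega>1" if "r \<le> T" for r
      using that eq by (simp add: path_value_def)
    have gain_eq: "total_gain m r \<omega>2 = total_gain m r \<omega>1" if "s \<le> r" "r \<le> T" for r
      using that s by (intro total_gain_agree \<omega>2 \<omega>1 agree_upto_sym[OF agree]) auto
    have main: "total_gain (Suc m) r \<omega>2 - total_gain (Suc m) s \<omega>2
        \<le> path_value lo hi g t r \<omega>2 - path_value lo hi g t s \<omega>2 + real (Suc m) * \<epsilon>"
      if r: "s \<le> r" "ennreal r \<le> max (ennreal s) (\<tau> (Suc m) \<omega>2)" for r
    proof (cases "r \<le> T")
      case True
      have "leg m r \<omega>2 = leg m s \<omega>2"
      proof (cases "T = s")
        case True
        then show ?thesis using r \<open>r \<le> T\<close> by simp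
      next
        case False
        then have "r \<le> u" "s \<le> u" using T \<open>r \<le> T\<close> r by auto
        then show ?thesis
          using \<omega>2 r s \<tau>2 by (simp add: leg_zero_before ennreal_leI)
      qed
      moreover have "total_gain m r \<omega>1 - total_gain m s \<omega>1
          \<le> path_value lo hi g t r \<omega>1 - path_value lo hi g t s \<omega>1 + real m * \<epsilon>"
        using r True by (intro IH) (auto simp: T_max ennreal_leI)
      moreover have "total_gain (Suc m) r \<omega>2 - total_gain (Suc m) s \<omega>2
          = (total_gain m r \<omega>1 + leg m r \<omega>2) - (total_gain m s \<omega>1 + leg m s \<omega>2)"
        using gain_eq[OF r(1) True] gain_eq[OF order_refl T(2)] by (simp add: total_gain_def)
      ultimately show ?thesis
        using value_eq[OF True] value_eq[OF T(2)] \<epsilon> by (simp add: algebra_simps)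
    next
      case False
      then have "\<not> ennreal r \<le> ennreal s"
        using r T s by simp
      then have \<tau>3: "ennreal r \<le> \<tau> (Suc m) \<omega>2"
        using r by (simp add: le_max_iff_disj)
      then have "ennreal s \<le> \<tau> (Suc m) \<omega>2"
        using r by (meson ennreal_leI order.trans)
      then have ends: "stop_at (\<tau> (Suc m)) r \<omega>2 = r" "stop_at (\<tau> (Suc m)) s \<omega>2 = s"
        using \<tau>3 r s by (simp_all add: stop_at_before)
      have begin_r: "stop_at (\<tau> m) r \<omega>2 = u"
        using False T u \<tau>2 by (simp add: stop_at_after ennreal_leI)
      have legs: "leg m r \<omega>2 - leg m s \<omega>2 = trade_gain lo hi (p m \<omega>1) (q m \<omega>1) \<omega>2 T r"
      proof (cases "u \<le> s")
        case True
        then have "stop_at (\<tau> m) s \<omega>2 = u" "T = s"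
          using u \<tau>2 T by (simp_all add: stop_at_after ennreal_leI T_def)
        then show ?thesis
          using trade_gain_add[of lo hi "p m \<omega>1" "q m \<omega>1" \<omega>2 u s r]
          by (simp add: leg_def begin_r ends pq)
      next
        case False
        then have "stop_at (\<tau> m) s \<omega>2 = s" "T = u"
          using s \<tau>2 by (simp_all add: stop_at_before ennreal_leI T_def)
        then show ?thesis
          by (simp add: leg_def begin_r ends pq)
      qed
      have "total_gain m r \<omega>2 = total_gain m T \<omega>2"
        using False T \<tau>2 by (intro total_gain_constant_after \<omega>2) (auto simp: ennreal_leI)
      then have "total_gain (Suc m) r \<omega>2 - total_gain (Suc m) s \<omega>2
          = (total_gain m T \<omega>1 - total_gain m s \<omega>1) + (leg m r \<omega>2 - leg m s \<omega>2)"
        using gain_eq[OF T(2) order_refl] gain_eq[OF order_refl T(2)] by (simp add: total_gain_def)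
      moreover have "total_gain m T \<omega>1 - total_gain m s \<omega>1
          \<le> path_value lo hi g t T \<omega>1 - path_value lo hi g t s \<omega>1 + real m * \<epsilon>"
        using T by (intro IH) (auto simp: T_max)
      moreover have "leg m r \<omega>2 - leg m s \<omega>2
          \<le> path_value lo hi g t r \<omega>2 - path_value lo hi g t T \<omega>2 + \<epsilon>"
        unfolding legs using False by (intro gain) auto
      ultimately show ?thesis
        using value_eq[OF order_refl] value_eq[OF T(2)] by (simp add: algebra_simps)
    qed
    have "agree_upto (ennreal s) \<omega> \<omega>2"
      using agree_upto_trans[OF \<omega>1(2) agree[OF s T(2)]] .
    then show ?thesis
      using \<omega>2 main by blast
  qed
qed

end

text \<open>
  Along the adversary's path the capital rises after \<open>s\<close> by at most the rise of the value function, up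
  to an arbitrarily small error, and the final value is the payoff. A capital that finally reaches the
  payoff must thus have been at least the value at time \<open>s\<close>.
\<close>

lemma semigroup_le_capital:
  assumes rates: "0 \<le> lo" "lo \<le> hi" and st: "0 \<le> s" "s \<le> t" and \<omega>: "\<omega> \<in> counting_paths"
    and strategy: "trading_strategy n \<tau> hu hl"
    and hedge: "\<And>\<omega>'. \<omega>' \<in> counting_paths \<Longrightarrow> agree_upto (ennreal s) \<omega> \<omega>' \<Longrightarrow>
      ereal (apply_bcontfun g (\<omega>' t)) \<le> Liminf at_top (\<lambda>r. ereal (capital lo hi n \<tau> hu hl c r \<omega>'))"
  shows "apply_bcontfun (poisson_semigroup lo hi (t - s) g) (\<omega> s) \<le> capital lo hi n \<tau> hu hl c s \<omega>"
proof -
  define \<tau>' where "\<tau>' j = (if j = 0 then (\<lambda>_. 0) else if j \<le> n + 1 then \<tau> j else (\<lambda>_. \<infinity>))" for j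
  define p where "p j \<omega> = (if 1 \<le> j \<and> j \<le> n then the (hu j \<omega>) else 0)" for j \<omega>
  define q where "q j \<omega> = (if 1 \<le> j \<and> j \<le> n then the (hl j \<omega>) else 0)" for j \<omega>
  have stake_hu: "stake (\<tau> j) (hu j)" and stake_hl: "stake (\<tau> j) (hl j)" if "1 \<le> j" "j \<le> n" for j
    using strategy that by (auto simp: trading_strategy_def)
  have stake_nonneg: "0 \<le> the (h \<omega>)"
    if "stake \<sigma> h" "\<omega> \<in> counting_paths" "\<sigma> \<omega> < \<infinity>" for \<sigma> and h :: "path \<rightharpoonup> real" and \<omega>
  proof -
    have "\<omega> \<in> dom h" using that by (auto simp: stake_def)
    then obtain y where "h \<omega> = Some y" by blast
    moreover from this have "y \<in> ran h" by (auto simp: ran_def)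
    ultimately show ?thesis using that by (simp add: stake_def)
  qed
  have stake_measurable: "h \<omega>2 = h \<omega>1"
    if "stake \<sigma> h" "stopping_time \<sigma>" "\<omega>1 \<in> counting_paths" "\<omega>2 \<in> counting_paths" "\<sigma> \<omega>1 < \<infinity>"
      "agree_upto (\<sigma> \<omega>1) \<omega>1 \<omega>2" for \<sigma> and h :: "path \<rightharpoonup> real" and \<omega>1 \<omega>2
  proof -
    have "\<sigma> \<omega>2 = \<sigma> \<omega>1" using stopping_time_eq[OF that(2,3,4,6) order_refl] .
    then have "\<omega>1 \<in> dom h" "\<omega>2 \<in> dom h" using that by (auto simp: stake_def)
    then show ?thesis using that(1,6) unfolding stake_def stopping_measurable_def by metis
  qed
  interpret trading_sequence lo hi \<tau>' p q
  proof
    show st': "stopping_time (\<tau>' j)" for j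
      using strategy by (auto simp: trading_strategy_def \<tau>'_def stopping_time_const)
    show "\<tau>' j \<omega> \<le> \<tau>' (Suc j) \<omega>" if "\<omega> \<in> counting_paths" for j \<omega>
      using strategy that by (auto simp: trading_strategy_def \<tau>'_def)
    show "0 \<le> p j \<omega> \<and> 0 \<le> q j \<omega>" if "\<omega> \<in> counting_paths" "\<tau>' j \<omega> < \<infinity>" for j \<omega>
    proof (cases "1 \<le> j \<and> j \<le> n")
      case True
      then have "\<tau> j \<omega> < \<infinity>" using that by (simp add: \<tau>'_def)
      then have "0 \<le> the (hu j \<omega>)" "0 \<le> the (hl j \<omega>)"
        using True that(1) stake_nonneg stake_hu stake_hl by blast+
      then show ?thesis by (simp add: p_def q_def)
    qed (auto simp: p_def q_def)
    show "p j \<omega>2 = p j \<omega>1 \<and> q j \<omega>2 = q j \<omega>1"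
      if "\<omega>1 \<in> counting_paths" "\<omega>2 \<in> counting_paths" "\<tau>' j \<omega>1 < \<infinity>" "agree_upto (\<tau>' j \<omega>1) \<omega>1 \<omega>2" for j \<omega>1 \<omega>2
    proof (cases "1 \<le> j \<and> j \<le> n")
      case True
      then have "\<tau>' j = \<tau> j" by (simp add: \<tau>'_def)
      then have "hu j \<omega>2 = hu j \<omega>1" "hl j \<omega>2 = hl j \<omega>1"
        using True st'[of j] that stake_measurable stake_hu stake_hl by metis+
      then show ?thesis by (simp add: p_def q_def)
    qed (auto simp: p_def q_def)
  qed (use rates in \<open>auto simp: \<tau>'_def\<close>)
  have capital_eq: "capital lo hi n \<tau> hu hl c r \<omega> = c + total_gain (n + 2) r \<omega>" for r \<omega>
  proof -
    have "(\<Sum>j=1..n. leg j r \<omega>) = total_gain (n + 2) r \<omega>"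
      unfolding total_gain_def
      by (rule sum.mono_neutral_left) (auto simp: leg_def p_def q_def)
    moreover have "(\<Sum>j=1..n. leg j r \<omega>) = (\<Sum>k=1..n. trade_gain lo hi (the (hu k \<omega>)) (the (hl k \<omega>)) \<omega>
        (stop_at (\<tau> k) r \<omega>) (stop_at (\<tau> (Suc k)) r \<omega>))"
      by (intro sum.cong) (auto simp: leg_def p_def q_def \<tau>'_def stop_at_def)
    ultimately show ?thesis by (simp add: capital_eq_sum_trade_gain)
  qed
  show ?thesis
  proof (rule field_le_epsilon)
    fix e :: real assume e: "0 < e"
    define \<epsilon> where "\<epsilon> = e / real (n + 2)"
    have \<epsilon>: "0 < \<epsilon>" "real (n + 2) * \<epsilon> = e"
      using e by (simp_all add: \<epsilon>_def)
    obtain \<omega>' where \<omega>': "\<omega>' \<in> counting_paths" "agree_upto (ennreal s) \<omega> \<omega>'"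
      and gain: "\<And>r. s \<le> r \<Longrightarrow> total_gain (n + 2) r \<omega>' - total_gain (n + 2) s \<omega>'
        \<le> path_value lo hi g t r \<omega>' - path_value lo hi g t s \<omega>' + e"
      using adversary_path[OF \<omega> st(1) \<epsilon>(1), of "n + 2" g t] \<epsilon>(2) by (auto simp: \<tau>'_def)
    let ?B = "apply_bcontfun g (\<omega>' t) + (capital lo hi n \<tau> hu hl c s \<omega>
        - apply_bcontfun (poisson_semigroup lo hi (t - s) g) (\<omega> s) + e)"
    have same: "capital lo hi n \<tau> hu hl c s \<omega>' = capital lo hi n \<tau> hu hl c s \<omega>" "\<omega>' s = \<omega> s"
      using total_gain_agree[OF \<omega> \<omega>'(1) st(1) \<omega>'(2)] agree_uptoD[OF \<omega>'(2) st(1)]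
      by (simp_all add: capital_eq)
    have "capital lo hi n \<tau> hu hl c r \<omega>' \<le> ?B" if "t \<le> r" for r
      using gain[of r] that st path_value_after[OF rates that] same
      by (simp add: capital_eq path_value_def)
    then have "Liminf at_top (\<lambda>r. ereal (capital lo hi n \<tau> hu hl c r \<omega>')) \<le> Liminf at_top (\<lambda>r::real. ereal ?B)"
      by (intro Liminf_mono eventually_mono[OF eventually_ge_at_top[of t]]) auto
    also have "\<dots> = ereal ?B" by (simp add: Liminf_const)
    finally have "ereal (apply_bcontfun g (\<omega>' t)) \<le> ereal ?B"
      using hedge[OF \<omega>'] order.trans by blast
    then show "apply_bcontfun (poisson_semigroup lo hi (t - s) g) (\<omega> s)
        \<le> capital lo hi n \<tau> hu hl c s \<omega> + e" by simp
  qed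
qed


section \<open>A superhedging strategy\<close>

text \<open>
  The first jump time after \<open>a\<close>, or \<open>b\<close> if there is none before \<open>b\<close>.
\<close>

definition jump_or_end :: "real \<Rightarrow> real \<Rightarrow> path \<Rightarrow> real" where
  "jump_or_end a b \<omega> = Inf (insert b {r. a \<le> r \<and> \<omega> a < \<omega> r})"

lemma jump_or_end_le:
  assumes "a \<le> b"
  shows "jump_or_end a b \<omega> \<le> b" "a \<le> r \<Longrightarrow> \<omega> a < \<omega> r \<Longrightarrow> jump_or_end a b \<omega> \<le> r"
  unfolding jump_or_end_def
  by (rule cInf_lower; use assms in \<open>auto intro!: bdd_belowI[of _ a]\<close>)+

lemma le_jump_or_end: "a \<le> b \<Longrightarrow> a \<le> jump_or_end a b \<omega>"
  unfolding jump_or_end_def by (rule cInf_greatest) auto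

lemma constant_before_jump:
  assumes "\<omega> \<in> counting_paths" "0 \<le> a" "a \<le> b" "a \<le> r" "r < jump_or_end a b \<omega>"
  shows "\<omega> r = \<omega> a"
  using jump_or_end_le(2)[OF assms(3,4), of \<omega>] counting_path_mono[OF assms(1,2,4)] assms(5) by linarith

text \<open>
  An infimum of jump times below \<open>b\<close> is attained, by right-continuity.
\<close>

lemma jump_before_end:
  assumes \<omega>: "\<omega> \<in> counting_paths" and ab: "0 \<le> a" "a \<le> b" and lt: "jump_or_end a b \<omega> < b"
  shows "\<omega> a < \<omega> (jump_or_end a b \<omega>)"
proof -
  let ?\<rho> = "jump_or_end a b \<omega>"
  have "0 \<le> ?\<rho>" using ab le_jump_or_end[of a b \<omega>] by linarith
  then obtain v where v: "?\<rho> < v" "\<And>r. ?\<rho> \<le> r \<Longrightarrow> r < v \<Longrightarrow> \<omega> r = \<omega> ?\<rho>"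
    using counting_path_right_locally_constant[OF \<omega>] by blast
  have "Inf (insert b {r. a \<le> r \<and> \<omega> a < \<omega> r}) < min v b"
    using v(1) lt by (simp add: jump_or_end_def)
  then obtain r where r: "r \<in> insert b {r. a \<le> r \<and> \<omega> a < \<omega> r}" "r < min v b"
    by (meson cInf_lessD insert_not_empty)
  then have "a \<le> r" "\<omega> a < \<omega> r" by auto
  moreover from this have "?\<rho> \<le> r" by (rule jump_or_end_le(2)[OF ab(2)])
  ultimately show ?thesis using v(2)[of r] r by simp
qed

text \<open>
  The path is constant before the first jump, and its jumps have size one.
\<close>

lemma at_most_one_jump:
  assumes \<omega>: "\<omega> \<in> counting_paths" and ab: "0 \<le> a" "a \<le> b"
  shows "\<omega> (jump_or_end a b \<omega>) \<le> \<omega> a + 1"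
proof (cases "jump_or_end a b \<omega> = a")
  case False
  let ?\<rho> = "jump_or_end a b \<omega>"
  have "a < ?\<rho>" using False le_jump_or_end[OF ab(2), of \<omega>] by simp
  then have "0 < ?\<rho>" using ab by linarith
  then obtain l v where l: "v < ?\<rho>" "\<And>r. v < r \<Longrightarrow> r < ?\<rho> \<Longrightarrow> \<omega> r = l" "\<omega> ?\<rho> = l \<or> \<omega> ?\<rho> = l + 1"
    using counting_path_left_locally_constant[OF \<omega>] by metis
  obtain r where r: "max v a < r" "r < ?\<rho>"
    using dense[of "max v a" ?\<rho>] l(1) \<open>a < ?\<rho>\<close> by auto
  then have "\<omega> r = l" "\<omega> r = \<omega> a"
    using l(2)[of r] constant_before_jump[OF \<omega> ab, of r] by auto
  then show ?thesis using l(3) by auto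
qed simp

lemma stopping_time_jump_or_end:
  assumes ab: "0 \<le> a" "a \<le> b"
  shows "stopping_time (\<lambda>\<omega>. ennreal (jump_or_end a b \<omega>))"
  unfolding stopping_time_def
proof (intro ballI impI)
  fix \<omega>1 \<omega>2
  assume \<omega>: "\<omega>1 \<in> counting_paths" "\<omega>2 \<in> counting_paths"
    and agree: "agree_upto (ennreal (jump_or_end a b \<omega>1)) \<omega>1 \<omega>2"
  let ?\<rho>1 = "jump_or_end a b \<omega>1" and ?\<rho>2 = "jump_or_end a b \<omega>2"
  have eq: "\<omega>1 r = \<omega>2 r" if "a \<le> r" "r \<le> ?\<rho>1" for r
    using agree_uptoD[OF agree] that ab by simp
  have a: "a \<le> ?\<rho>1" "a \<le> ?\<rho>2" "?\<rho>1 \<le> b" "?\<rho>2 \<le> b"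
    using ab by (simp_all add: le_jump_or_end jump_or_end_le)
  have "?\<rho>2 \<le> ?\<rho>1"
  proof (cases "?\<rho>1 < b")
    case True
    then have "\<omega>2 a < \<omega>2 ?\<rho>1"
      using jump_before_end[OF \<omega>(1) ab] eq[of a] eq[of ?\<rho>1] a by simp
    then show ?thesis by (rule jump_or_end_le(2)[OF ab(2) a(1)])
  qed (use a in simp)
  moreover have "?\<rho>1 \<le> ?\<rho>2"
  proof (rule ccontr)
    assume "\<not> ?\<rho>1 \<le> ?\<rho>2"
    then have "\<omega>1 a < \<omega>1 ?\<rho>2"
      using jump_before_end[OF \<omega>(2) ab] eq[of a] eq[of ?\<rho>2] a by simp
    then show False
      using jump_or_end_le(2)[OF ab(2) a(2), of \<omega>1] \<open>\<not> ?\<rho>1 \<le> ?\<rho>2\<close> by simp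
  qed
  ultimately show "ennreal ?\<rho>1 = ennreal ?\<rho>2" by simp
qed

text \<open>
  For a fine enough cell \<open>[a, b]\<close> the two stakes superreplicate the step from the Euler value at \<open>a\<close> to
  \<open>f\<close> at \<open>b\<close>, up to the cost of holding \<open>\<epsilon>\<close>. Until the first jump at \<open>\<rho>\<close> the gain from \<open>D\<close> is exact.
  After it the stake \<open>B\<close>, which is at least the oscillation of \<open>f\<close>, covers all further jumps. The cost of
  \<open>B\<close> and the drift of \<open>D\<close> missed after \<open>\<rho>\<close> are each at most \<open>B hi (b - a)\<close>, and the \<open>\<epsilon>\<close> won at \<open>\<rho>\<close>
  pays for both.
\<close>

lemma hedge_one_interval:
  fixes f :: "nat \<Rightarrow>\<^sub>C real"
  assumes rates: "0 \<le> lo" "lo \<le> hi" and \<omega>: "\<omega> \<in> counting_paths" and ab: "0 \<le> a" "a \<le> b"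
    and B: "2 * norm f \<le> B" and \<epsilon>: "2 * B * hi * (b - a) \<le> \<epsilon>"
  defines "\<rho> \<equiv> jump_or_end a b \<omega>"
    and "D \<equiv> apply_bcontfun f (\<omega> a + 1) - apply_bcontfun f (\<omega> a)"
  shows "apply_bcontfun f (\<omega> b) - apply_bcontfun (euler_step lo hi (b - a) f) (\<omega> a) - \<epsilon> * hi * (b - a)
    \<le> trade_gain lo hi (max 0 D + \<epsilon>) (max 0 (- D)) \<omega> a \<rho> + trade_gain lo hi B 0 \<omega> \<rho> b"
proof -
  define m where "m = \<omega> a"
  define H where "H = apply_bcontfun (poisson_generator lo hi f) m"
  have \<rho>: "a \<le> \<rho>" "\<rho> \<le> b"
    using ab by (simp_all add: \<rho>_def le_jump_or_end jump_or_end_le)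
  have "0 \<le> B" using B norm_ge_zero[of f] by linarith
  moreover have "0 \<le> hi" using rates by simp
  ultimately have "0 \<le> 2 * B * hi * (b - a)" using ab by simp
  then have "0 \<le> \<epsilon>" using \<epsilon> by linarith
  have H: "H = hi * max 0 D - lo * max 0 (- D)"
  proof -
    have "H = max (lo * D) (hi * D)" by (simp add: H_def apply_poisson_generator D_def m_def)
    moreover have "0 \<le> D \<Longrightarrow> lo * D \<le> hi * D" "D \<le> 0 \<Longrightarrow> hi * D \<le> lo * D"
      using rates by (auto intro: mult_right_mono mult_right_mono_neg)
    ultimately show ?thesis by (cases "0 \<le> D") auto
  qed
  have euler: "apply_bcontfun (euler_step lo hi (b - a) f) m = apply_bcontfun f m + (b - a) * H"
    by (simp add: euler_step_def H_def)
  have first: "trade_gain lo hi (max 0 D + \<epsilon>) (max 0 (- D)) \<omega> a \<rho>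
      = (D + \<epsilon>) * (real (\<omega> \<rho>) - real m) - (\<rho> - a) * H - \<epsilon> * hi * (\<rho> - a)"
  proof -
    have "trade_gain lo hi (P + \<epsilon>) Q \<omega> a \<rho>
        = (P - Q + \<epsilon>) * (real (\<omega> \<rho>) - real m) - (\<rho> - a) * (hi * P - lo * Q) - \<epsilon> * hi * (\<rho> - a)" for P Q
      by (simp add: trade_gain_def m_def algebra_simps)
    moreover have "max 0 D - max 0 (- D) = D" by simp
    ultimately show ?thesis unfolding H by metis
  qed
  show ?thesis
  proof (cases "\<rho> = b")
    case True
    have "\<omega> b = m \<or> \<omega> b = Suc m"
      using at_most_one_jump[OF \<omega> ab] counting_path_mono[OF \<omega> ab] True
      by (auto simp: \<rho>_def m_def)
    then have "apply_bcontfun f (\<omega> b) - apply_bcontfun f m \<le> (D + \<epsilon>) * (real (\<omega> b) - real m)"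
      using \<open>0 \<le> \<epsilon>\<close> by (auto simp: D_def m_def)
    then show ?thesis
      using first True euler by (simp add: m_def)
  next
    case False
    then have "\<rho> < b" using \<rho> by simp
    then have "\<omega> \<rho> = Suc m"
      using at_most_one_jump[OF \<omega> ab] jump_before_end[OF \<omega> ab] by (auto simp: \<rho>_def m_def)
    moreover have "\<omega> \<rho> \<le> \<omega> b"
      using ab \<rho> by (intro counting_path_mono[OF \<omega>]) auto
    ultimately obtain l where l: "\<omega> b = Suc m + l"
      using le_Suc_ex by metis
    \<comment> \<open>Further jumps in the same interval are paid for by the crude stake \<open>B\<close>.\<close>
    have "apply_bcontfun f (\<omega> b) - apply_bcontfun f (Suc m) \<le> B * real l"
    proof (cases "l = 0")
      case False
      have "apply_bcontfun f (\<omega> b) - apply_bcontfun f (Suc m) \<le> 2 * norm f"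
        using norm_bounded[of f "\<omega> b"] norm_bounded[of f "Suc m"] by simp
      also have "\<dots> \<le> B * real l"
        using False B \<open>0 \<le> B\<close> mult_left_mono[of 1 "real l" B] by simp
      finally show ?thesis .
    qed (simp add: l)
    moreover have "trade_gain lo hi B 0 \<omega> \<rho> b = B * real l - B * hi * (b - \<rho>)"
      using l \<open>\<omega> \<rho> = Suc m\<close> by (simp add: trade_gain_def algebra_simps)
    moreover have "(D + \<epsilon>) * (real (\<omega> \<rho>) - real m) = apply_bcontfun f (Suc m) - apply_bcontfun f m + \<epsilon>"
      using \<open>\<omega> \<rho> = Suc m\<close> by (simp add: D_def m_def)
    moreover have "- (B * hi * (b - a)) \<le> (b - \<rho>) * H"
    proof -
      have "\<bar>H\<bar> \<le> 2 * hi * norm f"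
        using norm_bounded[of "poisson_generator lo hi f" m] norm_poisson_generator_le[OF rates, of f]
        by (simp add: H_def)
      also have "\<dots> \<le> B * hi"
        using mult_left_mono[OF B \<open>0 \<le> hi\<close>] by (simp add: algebra_simps)
      finally have "(b - \<rho>) * \<bar>H\<bar> \<le> (b - a) * (B * hi)"
        using \<rho> by (intro mult_mono) auto
      moreover have "- ((b - \<rho>) * \<bar>H\<bar>) \<le> (b - \<rho>) * H"
        using mult_left_mono[of "- \<bar>H\<bar>" H "b - \<rho>"] \<rho> by simp
      ultimately show ?thesis by (simp add: algebra_simps)
    qed
    moreover have "B * hi * (b - \<rho>) \<le> B * hi * (b - a)"
      using \<open>0 \<le> B\<close> \<open>0 \<le> hi\<close> \<rho> by (intro mult_left_mono) auto
    moreover have "\<epsilon> * hi * (\<rho> - a) \<le> \<epsilon> * hi * (b - a)"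
      using \<open>0 \<le> \<epsilon>\<close> \<open>0 \<le> hi\<close> \<rho> by (intro mult_left_mono) auto
    moreover have "(b - a) * H - (\<rho> - a) * H = (b - \<rho>) * H"
      by (simp add: algebra_simps)
    ultimately show ?thesis
      using first euler \<epsilon> unfolding m_def[symmetric] by linarith
  qed
qed

text \<open>
  Only the stake \<open>q\<close> loses from jumps, and it is held over at most one of them; all other losses are
  proportional to time.
\<close>

lemma hedge_bounded_below:
  fixes B :: real
  assumes rates: "0 \<le> lo" "lo \<le> hi" and \<omega>: "\<omega> \<in> counting_paths" and ab: "0 \<le> a" "a \<le> b" and r: "0 \<le> r"
    and p: "0 \<le> p" "p \<le> B + \<epsilon>" and q: "0 \<le> q" "q \<le> B"
  defines "\<rho> \<equiv> jump_or_end a b \<omega>"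
  shows "- ((B + \<epsilon>) * hi * (b - a) + B + B * hi * (b - a))
    \<le> trade_gain lo hi p q \<omega> (min a r) (min \<rho> r) + trade_gain lo hi B 0 \<omega> (min \<rho> r) (min b r)"
proof -
  have \<rho>: "a \<le> \<rho>" "\<rho> \<le> b"
    using ab by (simp_all add: \<rho>_def le_jump_or_end jump_or_end_le)
  have nn: "0 \<le> B" "0 \<le> hi" "0 \<le> B + \<epsilon>" using p q rates by auto
  let ?d = "min \<rho> r - min a r" and ?N = "real (\<omega> (min \<rho> r)) - real (\<omega> (min a r))"
  have d: "0 \<le> ?d" "?d \<le> b - a" using \<rho> by auto
  have "\<omega> (min a r) \<le> \<omega> (min \<rho> r)"
    using \<rho> ab r by (intro counting_path_mono[OF \<omega>]) auto
  moreover have "\<omega> (min \<rho> r) \<le> \<omega> (min a r) + 1"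
  proof (cases "r \<le> a")
    case False
    then have "\<omega> (min \<rho> r) \<le> \<omega> \<rho>"
      using \<rho> ab r by (intro counting_path_mono[OF \<omega>]) auto
    then show ?thesis
      using at_most_one_jump[OF \<omega> ab] False by (simp add: \<rho>_def min_def)
  next
    case True
    then have "min a r = r" "min \<rho> r = r" using \<rho> by auto
    then show ?thesis by simp
  qed
  ultimately have N: "0 \<le> ?N" "?N \<le> 1" by auto
  have "trade_gain lo hi p q \<omega> (min a r) (min \<rho> r) = p * ?N - p * (hi * ?d) + q * (lo * ?d) - q * ?N"
    by (simp add: trade_gain_def algebra_simps)
  moreover have "0 \<le> p * ?N" "0 \<le> q * (lo * ?d)"
    using p q N d rates by (auto intro!: mult_nonneg_nonneg)
  moreover have "q * ?N \<le> B * 1" using q N nn by (intro mult_mono) auto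
  moreover have "p * (hi * ?d) \<le> (B + \<epsilon>) * (hi * (b - a))"
    using p d nn by (intro mult_mono mult_left_mono) auto
  ultimately have first: "- ((B + \<epsilon>) * (hi * (b - a)) + B) \<le> trade_gain lo hi p q \<omega> (min a r) (min \<rho> r)"
    by linarith
  let ?d' = "min b r - min \<rho> r" and ?N' = "real (\<omega> (min b r)) - real (\<omega> (min \<rho> r))"
  have "\<omega> (min \<rho> r) \<le> \<omega> (min b r)"
    using \<rho> ab r by (intro counting_path_mono[OF \<omega>]) auto
  then have "0 \<le> B * ?N'" using nn by simp
  moreover have "B * (hi * ?d') \<le> B * (hi * (b - a))"
    using nn \<rho> by (intro mult_left_mono) auto
  moreover have "trade_gain lo hi B 0 \<omega> (min \<rho> r) (min b r) = B * ?N' - B * (hi * ?d')"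
    by (simp add: trade_gain_def algebra_simps)
  ultimately have "- (B * (hi * (b - a))) \<le> trade_gain lo hi B 0 \<omega> (min \<rho> r) (min b r)"
    by linarith
  then show ?thesis using first by (simp add: mult.assoc)
qed

lemma sum_consecutive_pairs: "(\<Sum>j=1..2 * k. F j) = (\<Sum>i<k. F (2 * i + 1) + F (2 * i + 2))"
  for F :: "nat \<Rightarrow> real"
  by (induction k) (simp_all add: add.assoc)

lemma stop_at_ennreal: "0 \<le> r \<Longrightarrow> 0 \<le> x \<omega> \<Longrightarrow> stop_at (\<lambda>\<omega>. ennreal (x \<omega>)) r \<omega> = min (x \<omega>) r"
  by (simp add: stop_at_def min_def)

lemma stake_restrict_counting_paths:
  assumes "\<And>\<omega>1 \<omega>2. \<omega>1 \<in> counting_paths \<Longrightarrow> \<omega>2 \<in> counting_paths \<Longrightarrow> agree_upto (\<tau> \<omega>1) \<omega>1 \<omega>2 \<Longrightarrow> h \<omega>1 = h \<omega>2"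
    and "\<And>\<omega>. \<omega> \<in> counting_paths \<Longrightarrow> 0 \<le> h \<omega> \<and> h \<omega> \<le> M"
  shows "stake \<tau> ((\<lambda>\<omega>. Some (h \<omega>)) |` counting_paths)"
proof -
  let ?h = "(\<lambda>\<omega>. Some (h \<omega>)) |` counting_paths"
  have dom: "dom ?h = counting_paths" by (auto simp: restrict_map_def dom_def)
  have ran: "ran ?h = h ` counting_paths" by (auto simp: ran_def restrict_map_def)
  have "stopping_measurable \<tau> ?h"
    unfolding stopping_measurable_def dom by (metis assms(1) restrict_in)
  moreover have "bounded (h ` counting_paths)"
    using assms(2) by (intro boundedI[of _ M]) auto
  ultimately show ?thesis
    unfolding stake_def dom ran using assms(2) by auto
qed

text \<open>
  The hedge of a single cell is repeated on each of the \<open>k\<close> cells of the grid. The stopping times are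
  numbered so that \<open>\<tau> (2 i + 1)\<close> is the beginning of cell \<open>i\<close> and \<open>\<tau> (2 i + 2)\<close> is its first jump, if
  any, and its end otherwise. The results for the cells telescope to the payoff minus the Euler value
  at time \<open>s\<close>.
\<close>

lemma superhedging_capital:
  assumes rates: "0 \<le> lo" "lo \<le> hi" and st: "0 \<le> s" "s \<le> t" and k: "1 \<le> k"
    and \<delta>: "\<delta> = (t - s) / real k" "\<delta> * hi \<le> 1" and \<epsilon>: "4 * norm g * hi * \<delta> \<le> \<epsilon>"
  obtains K where "K \<in> capital_processes lo hi"
    "\<And>\<omega>. \<omega> \<in> counting_paths \<Longrightarrow> K s \<omega> = c"
    "\<exists>M. \<forall>r\<ge>0. \<forall>\<omega>\<in>counting_paths. M \<le> K r \<omega>"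
    "\<And>r \<omega>. t \<le> r \<Longrightarrow> \<omega> \<in> counting_paths \<Longrightarrow>
      c + apply_bcontfun g (\<omega> t) - apply_bcontfun ((euler_step lo hi \<delta> ^^ k) g) (\<omega> s) - \<epsilon> * hi * (t - s) \<le> K r \<omega>"
proof -
  define u where "u i = s + real i * \<delta>" for i
  define \<rho> where "\<rho> i = jump_or_end (u i) (u (Suc i))" for i
  define f where "f i = (euler_step lo hi \<delta> ^^ (k - i)) g" for i
  define D where "D i \<omega> = apply_bcontfun (f (Suc i)) (\<omega> (u i) + 1) - apply_bcontfun (f (Suc i)) (\<omega> (u i))" for i \<omega>
  define B where "B = 2 * norm g"
  define \<tau> where "\<tau> j = (if odd j then (\<lambda>_. ennreal (u (j div 2))) else (\<lambda>\<omega>. ennreal (\<rho> (j div 2 - 1) \<omega>)))" for j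
  define hu where "hu j = (if odd j then (\<lambda>\<omega>. Some (max 0 (D (j div 2) \<omega>) + \<epsilon>)) else (\<lambda>\<omega>. Some B)) |` counting_paths" for j
  define hl where "hl j = (if odd j then (\<lambda>\<omega>. Some (max 0 (- D (j div 2) \<omega>))) else (\<lambda>\<omega>. Some 0)) |` counting_paths" for j
  have \<delta>0: "0 \<le> \<delta>" using st \<delta>(1) by simp
  have \<epsilon>0: "0 \<le> \<epsilon>"
    using order.trans[OF _ \<epsilon>] rates \<delta>0 by simp
  have u: "s \<le> u i" "0 \<le> u i" "u i \<le> u (Suc i)" "u (Suc i) - u i = \<delta>" for i
    using st \<delta>0 by (auto simp: u_def algebra_simps)
  have u_ends: "u 0 = s" "u k = t"
    using k by (simp_all add: u_def \<delta>(1))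
  have u_le: "u i \<le> t" if "i \<le> k" for i
    unfolding u_ends(2)[symmetric] u_def using that \<delta>0 by (simp add: mult_right_mono)
  have \<rho>: "u i \<le> \<rho> i \<omega>" "\<rho> i \<omega> \<le> u (Suc i)" "0 \<le> \<rho> i \<omega>" for i \<omega>
    using u[of i] le_jump_or_end[of "u i" "u (Suc i)" \<omega>] jump_or_end_le(1)[of "u i" "u (Suc i)" \<omega>]
    by (auto simp: \<rho>_def)
  have norm_f: "2 * norm (f i) \<le> B" for i
    using norm_euler_power_le[OF rates \<delta>0 \<delta>(2), of "k - i" g] by (simp add: f_def B_def)
  have D: "\<bar>D i \<omega>\<bar> \<le> B" for i \<omega>
    using norm_bounded[of "f (Suc i)" "\<omega> (u i)"] norm_bounded[of "f (Suc i)" "\<omega> (u i) + 1"] norm_f[of "Suc i"]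
    by (simp add: D_def)
  have D_agree: "D i \<omega>1 = D i \<omega>2" if "agree_upto (ennreal (u i)) \<omega>1 \<omega>2" for i \<omega>1 \<omega>2
    using agree_uptoD[OF that u(2)] by (simp add: D_def)
  have "trading_strategy (2 * k) \<tau> hu hl"
    unfolding trading_strategy_def
  proof (intro conjI ballI)
    show "1 \<le> 2 * k" using k by simp
    show "stopping_time (\<tau> j)" for j
      by (simp add: \<tau>_def \<rho>_def stopping_time_const stopping_time_jump_or_end u)
    show "\<tau> j \<omega> \<le> \<tau> (j + 1) \<omega>" if "j \<in> {1..2 * k}" for j \<omega>
    proof (cases "odd j")
      case True
      then show ?thesis by (auto simp: \<tau>_def \<rho> ennreal_leI elim!: oddE)
    next
      case False
      then have "j = 2 * Suc (j div 2 - 1)" using that by auto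
      then obtain i where "j = 2 * Suc i" ..
      then show ?thesis by (simp add: \<tau>_def \<rho> ennreal_leI)
    qed
    have fine_stake: "stake (\<lambda>_. ennreal (u i)) ((\<lambda>\<omega>. Some (F (D i \<omega>))) |` counting_paths)"
      if "\<And>d. \<bar>d\<bar> \<le> B \<Longrightarrow> 0 \<le> F d \<and> F d \<le> B + \<epsilon>" for i F
    proof (rule stake_restrict_counting_paths)
      fix \<omega>1 \<omega>2 assume "agree_upto (ennreal (u i)) \<omega>1 \<omega>2"
      then show "F (D i \<omega>1) = F (D i \<omega>2)" by (simp only: D_agree)
    qed (rule that[OF D])
    have crude_stake: "stake \<sigma> ((\<lambda>\<omega>. Some b) |` counting_paths)" if "0 \<le> b" for \<sigma> b
      by (rule stake_restrict_counting_paths[where M = b]) (use that in auto)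
    show "stake (\<tau> j) (hu j)" for j
      using fine_stake[of "\<lambda>d. max 0 d + \<epsilon>" "j div 2"] crude_stake[of B] \<epsilon>0
      by (simp add: hu_def \<tau>_def B_def)
    show "stake (\<tau> j) (hl j)" for j
      using fine_stake[of "\<lambda>d. max 0 (- d)" "j div 2"] crude_stake[of 0] \<epsilon>0
      by (simp add: hl_def \<tau>_def)
  qed
  define K where "K = capital lo hi (2 * k) \<tau> hu hl c"
  define first where "first i r \<omega> = trade_gain lo hi (max 0 (D i \<omega>) + \<epsilon>) (max 0 (- D i \<omega>)) \<omega> (min (u i) r) (min (\<rho> i \<omega>) r)" for i r \<omega>
  define second where "second i r \<omega> = trade_gain lo hi B 0 \<omega> (min (\<rho> i \<omega>) r) (min (u (Suc i)) r)" for i r \<omega>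
  have K_eq: "K r \<omega> = c + (\<Sum>i<k. first i r \<omega> + second i r \<omega>)" if "\<omega> \<in> counting_paths" "0 \<le> r" for r \<omega>
    unfolding K_def capital_eq_sum_trade_gain sum_consecutive_pairs first_def second_def
    using that by (simp add: \<tau>_def hu_def hl_def stop_at_ennreal u \<rho>)
  show thesis
  proof (rule that)
    show "K \<in> capital_processes lo hi"
      using \<open>trading_strategy (2 * k) \<tau> hu hl\<close> unfolding K_def capital_processes_def by blast
    show "K s \<omega> = c" if "\<omega> \<in> counting_paths" for \<omega>
    proof -
      have "s \<le> \<rho> i \<omega>" for i using u(1)[of i] \<rho>(1)[of i \<omega>] by linarith
      then show ?thesis
        using K_eq[OF that st(1)] u(1) by (simp add: first_def second_def min_absorb2)
    qed
    show "\<exists>M. \<forall>r\<ge>0. \<forall>\<omega>\<in>counting_paths. M \<le> K r \<omega>"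
    proof (intro exI allI impI ballI)
      fix r \<omega> assume r: "0 \<le> (r::real)" and \<omega>: "\<omega> \<in> counting_paths"
      have "- ((B + \<epsilon>) * hi * \<delta> + B + B * hi * \<delta>) \<le> first i r \<omega> + second i r \<omega>" for i
        using hedge_bounded_below[OF rates \<omega> u(2) u(3) r, of "max 0 (D i \<omega>) + \<epsilon>" B \<epsilon> "max 0 (- D i \<omega>)" i]
          D[of i \<omega>] \<epsilon>0
        by (simp add: first_def second_def \<rho>_def u(4) abs_le_iff)
      then have "(\<Sum>i<k. - ((B + \<epsilon>) * hi * \<delta> + B + B * hi * \<delta>)) \<le> (\<Sum>i<k. first i r \<omega> + second i r \<omega>)"
        by (intro sum_mono)
      then show "c + (\<Sum>i<k. - ((B + \<epsilon>) * hi * \<delta> + B + B * hi * \<delta>)) \<le> K r \<omega>"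
        unfolding K_eq[OF \<omega> r] by (rule add_left_mono)
    qed
    fix r \<omega> assume r: "t \<le> (r::real)" and \<omega>: "\<omega> \<in> counting_paths"
    have "(\<Sum>i<k. apply_bcontfun (f (Suc i)) (\<omega> (u (Suc i))) - apply_bcontfun (f i) (\<omega> (u i)) - \<epsilon> * hi * \<delta>)
        \<le> (\<Sum>i<k. first i r \<omega> + second i r \<omega>)"
    proof (rule sum_mono)
      fix i assume "i \<in> {..<k}"
      then have i: "i < k" by simp
      have "u (Suc i) \<le> r" using u_le[of "Suc i"] i r by simp
      then have "u i \<le> r" "\<rho> i \<omega> \<le> r" "u (Suc i) \<le> r"
        using u(3)[of i] \<rho>(2)[of i \<omega>] by linarith+
      then have split: "first i r \<omega> + second i r \<omega> = trade_gain lo hi (max 0 (D i \<omega>) + \<epsilon>) (max 0 (- D i \<omega>)) \<omega> (u i) (\<rho> i \<omega>)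
          + trade_gain lo hi B 0 \<omega> (\<rho> i \<omega>) (u (Suc i))"
        by (simp add: first_def second_def min_absorb1)
      have "f i = euler_step lo hi \<delta> (f (Suc i))"
        using i by (simp add: f_def flip: Suc_diff_Suc)
      then show "apply_bcontfun (f (Suc i)) (\<omega> (u (Suc i))) - apply_bcontfun (f i) (\<omega> (u i)) - \<epsilon> * hi * \<delta>
          \<le> first i r \<omega> + second i r \<omega>"
        using hedge_one_interval[OF rates \<omega> u(2) u(3) norm_f[of "Suc i"], of i \<epsilon>] \<epsilon>
        by (simp add: split u(4) B_def D_def \<rho>_def)
    qed
    also have "(\<Sum>i<k. apply_bcontfun (f (Suc i)) (\<omega> (u (Suc i))) - apply_bcontfun (f i) (\<omega> (u i)) - \<epsilon> * hi * \<delta>)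
        = apply_bcontfun (f k) (\<omega> (u k)) - apply_bcontfun (f 0) (\<omega> (u 0)) - \<epsilon> * hi * (t - s)"
    proof -
      have "(\<Sum>i<m. F (Suc i) - F i - x) = F m - F 0 - real m * x" for F :: "nat \<Rightarrow> real" and m x
        by (induction m) (simp_all add: algebra_simps)
      from this[of "\<lambda>i. apply_bcontfun (f i) (\<omega> (u i))" "\<epsilon> * hi * \<delta>" k] show ?thesis
        using k by (simp add: \<delta>(1))
    qed
    finally show "c + apply_bcontfun g (\<omega> t) - apply_bcontfun ((euler_step lo hi \<delta> ^^ k) g) (\<omega> s) - \<epsilon> * hi * (t - s) \<le> K r \<omega>"
      using K_eq[OF \<omega>, of r] r st u_ends by (simp add: f_def)
  qed
qed


section \<open>The upper expectation\<close>

theorem theorem2: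
  fixes lo hi s t :: real and g :: "nat \<Rightarrow> real" and \<omega> :: path
  assumes "0 \<le> lo" and "lo \<le> hi"
    and "0 \<le> s" and "s \<le> t"
    and "bounded (range g)"
    and "\<omega> \<in> counting_paths"
  shows "upper_expectation lo hi
           ((\<lambda>\<omega>'. Some (ereal (g (\<omega>' t)))) |` counting_paths) (\<lambda>_. ennreal s) \<omega>
         = ereal (apply_bcontfun (poisson_semigroup lo hi (t - s) (Bcontfun g)) (\<omega> s))"
proof -
  define h where "h = Bcontfun g"
  have g: "apply_bcontfun h = g"
    unfolding h_def by (rule apply_Bcontfun_nat[OF assms(5)])
  let ?S = "apply_bcontfun (poisson_semigroup lo hi (t - s) h) (\<omega> s)"
  let ?f = "(\<lambda>\<omega>'. Some (ereal (g (\<omega>' t)))) |` counting_paths"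
  have cylinder: "\<omega>' \<in> cylinder (\<lambda>_. ennreal s) \<omega> \<longleftrightarrow> \<omega>' \<in> counting_paths \<and> agree_upto (ennreal s) \<omega> \<omega>'" for \<omega>'
    by (auto simp: cylinder_def)
  have "ereal ?S \<le> upper_expectation lo hi ?f (\<lambda>_. ennreal s) \<omega>"
    unfolding upper_expectation_def
  proof (rule Inf_greatest, clarify)
    fix K assume "K \<in> capital_processes lo hi"
      and hedge: "\<forall>\<omega>'\<in>cylinder (\<lambda>_. ennreal s) \<omega>. the (?f \<omega>') \<le> Liminf at_top (\<lambda>t. ereal (K t \<omega>'))"
    then obtain n \<tau> hu hl c where K: "K = capital lo hi n \<tau> hu hl c" "trading_strategy n \<tau> hu hl"
      by (auto simp: capital_processes_def)
    have "?S \<le> capital lo hi n \<tau> hu hl c s \<omega>"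
      using hedge by (intro semigroup_le_capital assms K) (auto simp: K cylinder g)
    then show "ereal ?S \<le> ereal (K (enn2real (ennreal s)) \<omega>)"
      using assms(3) by (simp add: K)
  qed
  moreover have "upper_expectation lo hi ?f (\<lambda>_. ennreal s) \<omega> \<le> ereal ?S"
  proof (rule ereal_le_epsilon2)
    fix e :: real assume e: "0 < e"
    let ?D = "t - s"
    have hi: "0 \<le> hi" and D: "0 \<le> ?D" using assms by auto
    \<comment> \<open>Half of the error pays for holding \<open>\<epsilon>\<close>, the other half for the Euler approximation.\<close>
    define \<epsilon> where "\<epsilon> = e / (2 * (hi * ?D + 1))"
    have "0 \<le> hi * ?D" using hi D by simp
    then have \<epsilon>0: "0 < \<epsilon>" "\<epsilon> * (2 * (hi * ?D + 1)) = e"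
      using e by (auto simp: \<epsilon>_def)
    then have \<epsilon>: "0 < \<epsilon>" "\<epsilon> * hi * ?D \<le> e / 2"
      by (auto simp: algebra_simps)
    have "(\<lambda>k. apply_bcontfun ((euler_step lo hi (?D / real k) ^^ k) h) (\<omega> s)) \<longlonglongrightarrow> ?S"
      using euler_scheme_tendsto[OF assms(1,2) D, of h] by (rule tendsto_apply_bcontfun)
    then have "\<forall>\<^sub>F k in sequentially. apply_bcontfun ((euler_step lo hi (?D / real k) ^^ k) h) (\<omega> s) < ?S + e / 2"
      using e by (intro order_tendstoD) auto
    moreover have "\<forall>\<^sub>F k in sequentially. ?D / real k * hi < 1"
      using tendsto_mult_left_zero[OF lim_const_over_n] by (rule order_tendstoD) simp
    moreover have "\<forall>\<^sub>F k in sequentially. 4 * norm h * hi * (?D / real k) < \<epsilon>"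
      using tendsto_mult_right_zero[OF lim_const_over_n] \<epsilon>(1) by (rule order_tendstoD)
    ultimately have "\<forall>\<^sub>F k in sequentially. 1 \<le> k \<and> apply_bcontfun ((euler_step lo hi (?D / real k) ^^ k) h) (\<omega> s) < ?S + e / 2
        \<and> ?D / real k * hi < 1 \<and> 4 * norm h * hi * (?D / real k) < \<epsilon>"
      using eventually_ge_at_top[of "1::nat"] by eventually_elim simp
    then obtain k :: nat where k: "1 \<le> k" and near: "apply_bcontfun ((euler_step lo hi (?D / real k) ^^ k) h) (\<omega> s) < ?S + e / 2"
      and fine: "?D / real k * hi < 1" "4 * norm h * hi * (?D / real k) < \<epsilon>"
      by (auto simp: eventually_sequentially)
    let ?E = "apply_bcontfun ((euler_step lo hi (?D / real k) ^^ k) h)"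
    define c where "c = ?E (\<omega> s) + \<epsilon> * hi * ?D"
    obtain K where K: "K \<in> capital_processes lo hi"
      and start: "\<And>\<omega>. \<omega> \<in> counting_paths \<Longrightarrow> K s \<omega> = c"
      and below: "\<exists>M. \<forall>r\<ge>0. \<forall>\<omega>\<in>counting_paths. M \<le> K r \<omega>"
      and final: "\<And>r \<omega>'. t \<le> r \<Longrightarrow> \<omega>' \<in> counting_paths \<Longrightarrow>
        c + apply_bcontfun h (\<omega>' t) - ?E (\<omega>' s) - \<epsilon> * hi * ?D \<le> K r \<omega>'"
      using superhedging_capital[OF assms(1-4) k refl less_imp_le[OF fine(1)] less_imp_le[OF fine(2)], of c]
      by blast
    obtain M where "\<And>r \<omega>'. 0 \<le> r \<Longrightarrow> \<omega>' \<in> counting_paths \<Longrightarrow> M \<le> K r \<omega>'"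
      using below by blast
    then have "ereal M \<le> (INF (r, \<omega>') \<in> {0..} \<times> counting_paths. ereal (K r \<omega>'))"
      by (intro INF_greatest) auto
    then have "- \<infinity> < (INF (r, \<omega>') \<in> {0..} \<times> counting_paths. ereal (K r \<omega>'))"
      by (rule less_le_trans[rotated]) simp
    moreover have "the (?f \<omega>') \<le> Liminf at_top (\<lambda>r. ereal (K r \<omega>'))" if "\<omega>' \<in> cylinder (\<lambda>_. ennreal s) \<omega>" for \<omega>'
    proof -
      have \<omega>': "\<omega>' \<in> counting_paths" "\<omega>' s = \<omega> s"
        using that assms(3) agree_uptoD[of s \<omega> \<omega>' s] by (auto simp: cylinder)
      have "g (\<omega>' t) \<le> K r \<omega>'" if "t \<le> r" for r
        using final[OF that \<omega>'(1)] \<omega>'(2) by (simp add: c_def g)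
      then have "ereal (g (\<omega>' t)) \<le> Liminf at_top (\<lambda>r. ereal (K r \<omega>'))"
        by (intro Liminf_bounded eventually_mono[OF eventually_ge_at_top[of t]]) auto
      then show ?thesis using \<omega>' by simp
    qed
    ultimately have "upper_expectation lo hi ?f (\<lambda>_. ennreal s) \<omega> \<le> ereal (K (enn2real (ennreal s)) \<omega>)"
      unfolding upper_expectation_def using K by (intro Inf_lower) blast
    also have "\<dots> = ereal c" using start[OF assms(6)] assms(3) by simp
    also have "\<dots> \<le> ereal ?S + ereal e"
      using near \<epsilon>(2) by (simp add: c_def)
    finally show "upper_expectation lo hi ?f (\<lambda>_. ennreal s) \<omega> \<le> ereal ?S + ereal e" .
  qed
  ultimately show ?thesis
    unfolding h_def by (rule antisym[rotated])
qed

end
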